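(* Let $H$ be a dual quasi-Hopf algebra over a field $k$ with 3-cocycle $\phi$, let $A$ be an $H$-comodule quasialgebra with coaction $\beta(a)=\sum a^{\bar{(1)}}\otimes a^{\bar{(2)}}\in A\otimes H$, and let $F:H\otimes H\to k$ be a 2-cochain. Then $A_F$, defined as the $H$-comodule $A$ (the coalgebras of $H$ and $H_F$ being the same) with the unchanged unit and with the new product $$a\cdot_F b=\sum a^{\bar{(1)}}b^{\bar{(1)}}\,F(a^{\bar{(2)}},b^{\bar{(2)}}),$$ is an $H_F$-comodule quasialgebra, where $H_F$ is the twist of $H$ by $F$.
   Context: Throughout $k$ is a field and $\Delta h=\sum h_{(1)}\otimes h_{(2)}$ is Sweedler notation. A dual quasibialgebra is a coalgebra $(H,\Delta,\epsilon)$ over $k$ with a (not necessarily associative) product $H\otimes H\to H$ with unit $1$, such that $\Delta,\epsilon$ are multiplicative and unital, together with a convolution-invertible linear map $\phi:H^{\otimes 3}\to k$ such that for all $a,b,c,d\in H$: $\sum a_{(1)}(b_{(1)}c_{(1)})\phi(a_{(2)},b_{(2)},c_{(2)})=\sum\phi(a_{(1)},b_{(1)},c_{(1)})(a_{(2)}b_{(2)})c_{(2)}$; $\sum\phi(b_{(1)},c_{(1)},d_{(1)})\phi(a_{(1)},b_{(2)}c_{(2)},d_{(2)})\phi(a_{(2)},b_{(3)},c_{(3)})=\sum\phi(a_{(1)},b_{(1)},c_{(1)}d_{(1)})\phi(a_{(2)}b_{(2)},c_{(2)},d_{(2)})$; $\phi(a,1,b)=\epsilon(a)\epsilon(b)$.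 It is a dual quasi-Hopf algebra if there are a linear map $S:H\to H$ and linear functionals $\alpha,\beta_H:H\to k$ with $\sum (Sa_{(1)})a_{(3)}\alpha(a_{(2)})=1\alpha(a)$, $\sum a_{(1)}(Sa_{(3)})\beta_H(a_{(2)})=1\beta_H(a)$, $\sum\phi(a_{(1)},Sa_{(3)},a_{(5)})\beta_H(a_{(2)})\alpha(a_{(4)})=\epsilon(a)$, $\sum\phi^{-1}(Sa_{(1)},a_{(3)},Sa_{(5)})\alpha(a_{(2)})\beta_H(a_{(4)})=\epsilon(a)$. A 2-cochain is a convolution-invertible linear map $F:H\otimes H\to k$ with $F(a,1)=F(1,a)=\epsilon(a)$. The twist $H_F$ is the dual quasi-Hopf algebra with the same coalgebra, unit and $S$ as $H$, and with $a\cdot_F b=\sum F^{-1}(a_{(1)},b_{(1)})a_{(2)}b_{(2)}F(a_{(3)},b_{(3)})$, $\phi_F(a,b,c)=\sum F^{-1}(b_{(1)},c_{(1)})F^{-1}(a_{(1)},b_{(2)}c_{(2)})\phi(a_{(2)},b_{(3)},c_{(3)})F(a_{(3)}b_{(4)},c_{(4)})F(a_{(4)},b_{(5)})$, $\alpha_F(a)=\sum F(Sa_{(1)},a_{(3)})\alpha(a_{(2)})$, $(\beta_H)_F(a)=\sum F^{-1}(a_{(1)},Sa_{(3)})\beta_H(a_{(2)})$. For a dual quasi-Hopf algebra $H$, an $H$-comodule quasialgebra is a right $H$-comodule $A$ with coaction $\beta:A\to A\otimes H$, $\beta(a)=\sum a^{\bar{(1)}}\otimes a^{\bar{(2)}}$,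 with a product $A\otimes A\to A$ and a two-sided unit $1\in A$, such that for all $a,b,c\in A$: $(ab)c=\sum a^{\bar{(1)}}(b^{\bar{(1)}}c^{\bar{(1)}})\,\phi(a^{\bar{(2)}},b^{\bar{(2)}},c^{\bar{(2)}})$, and $\beta(ab)=\beta(a)\beta(b)$, $\beta(1)=1\otimes 1$, using the tensor product algebra structure on $A\otimes H$. *)

theory Defs
  imports Complex_Main
begin

text \<open>
  Vector spaces over a field are whole types with an explicit scalar multiplication
  (locale \<^locale>\<open>vector_space\<close>). The library has no tensor product of such spaces, so
  tensors are handled by generators and relations: an element of \<open>V \<otimes> W\<close> (or \<open>V \<otimes> W \<otimes> U\<close>) is
  represented by a finite list of pure tensors, read as their sum, and equality of tensors is the
  least congruence on formal sums that makes the pure tensors multilinear. Thus \<open>comult H a\<close> below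
  is literally a choice of Sweedler legs \<open>[(a1, a2), \<dots>]\<close> of \<open>\<Delta> a\<close>. Maps out of a tensor
  product are curried multilinear maps; by \<open>tensor2_eq_sum_eq\<close> and
  \<open>tensor3_eq_sum_eq\<close> their value on a formal sum depends only on the tensor represented.
\<close>

inductive formal_sum_cong :: "('t list \<Rightarrow> 't list \<Rightarrow> bool) \<Rightarrow> 't list \<Rightarrow> 't list \<Rightarrow> bool"
  for R :: "'t list \<Rightarrow> 't list \<Rightarrow> bool"
where
  rel: "R xs ys \<Longrightarrow> formal_sum_cong R xs ys"
| refl: "formal_sum_cong R xs xs"
| sym: "formal_sum_cong R xs ys \<Longrightarrow> formal_sum_cong R ys xs"
| trans: "formal_sum_cong R xs ys \<Longrightarrow> formal_sum_cong R ys zs \<Longrightarrow> formal_sum_cong R xs zs"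
| comm: "formal_sum_cong R (xs @ ys) (ys @ xs)"
| app: "formal_sum_cong R xs xs' \<Longrightarrow> formal_sum_cong R ys ys' \<Longrightarrow>
    formal_sum_cong R (xs @ ys) (xs' @ ys')"

inductive bilinear_rel ::
  "('k::field \<Rightarrow> 'v::ab_group_add \<Rightarrow> 'v) \<Rightarrow> ('k \<Rightarrow> 'w::ab_group_add \<Rightarrow> 'w) \<Rightarrow>
    ('v \<times> 'w) list \<Rightarrow> ('v \<times> 'w) list \<Rightarrow> bool"
  for sV :: "'k::field \<Rightarrow> 'v::ab_group_add \<Rightarrow> 'v" and sW :: "'k \<Rightarrow> 'w::ab_group_add \<Rightarrow> 'w"
where
  "bilinear_rel sV sW [(0, y)] []"
| "bilinear_rel sV sW [(x + x', y)] [(x, y), (x', y)]"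
| "bilinear_rel sV sW [(x, y + y')] [(x, y), (x, y')]"
| "bilinear_rel sV sW [(sV c x, y)] [(x, sW c y)]"

inductive trilinear_rel ::
  "('k::field \<Rightarrow> 'v::ab_group_add \<Rightarrow> 'v) \<Rightarrow> ('k \<Rightarrow> 'w::ab_group_add \<Rightarrow> 'w) \<Rightarrow>
    ('k \<Rightarrow> 'u::ab_group_add \<Rightarrow> 'u) \<Rightarrow> ('v \<times> 'w \<times> 'u) list \<Rightarrow> ('v \<times> 'w \<times> 'u) list \<Rightarrow> bool"
  for sV :: "'k::field \<Rightarrow> 'v::ab_group_add \<Rightarrow> 'v" and sW :: "'k \<Rightarrow> 'w::ab_group_add \<Rightarrow> 'w"
    and sU :: "'k \<Rightarrow> 'u::ab_group_add \<Rightarrow> 'u"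
where
  "trilinear_rel sV sW sU [(0, y, z)] []"
| "trilinear_rel sV sW sU [(x + x', y, z)] [(x, y, z), (x', y, z)]"
| "trilinear_rel sV sW sU [(x, y + y', z)] [(x, y, z), (x, y', z)]"
| "trilinear_rel sV sW sU [(x, y, z + z')] [(x, y, z), (x, y, z')]"
| "trilinear_rel sV sW sU [(sV c x, y, z)] [(x, sW c y, z)]"
| "trilinear_rel sV sW sU [(x, sW c y, z)] [(x, y, sU c z)]"

definition tensor2_eq ::
  "('k::field \<Rightarrow> 'v::ab_group_add \<Rightarrow> 'v) \<Rightarrow> ('k \<Rightarrow> 'w::ab_group_add \<Rightarrow> 'w) \<Rightarrow>
    ('v \<times> 'w) list \<Rightarrow> ('v \<times> 'w) list \<Rightarrow> bool"
  where "tensor2_eq sV sW = formal_sum_cong (bilinear_rel sV sW)"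

definition tensor3_eq ::
  "('k::field \<Rightarrow> 'v::ab_group_add \<Rightarrow> 'v) \<Rightarrow> ('k \<Rightarrow> 'w::ab_group_add \<Rightarrow> 'w) \<Rightarrow>
    ('k \<Rightarrow> 'u::ab_group_add \<Rightarrow> 'u) \<Rightarrow> ('v \<times> 'w \<times> 'u) list \<Rightarrow> ('v \<times> 'w \<times> 'u) list \<Rightarrow> bool"
  where "tensor3_eq sV sW sU = formal_sum_cong (trilinear_rel sV sW sU)"

definition tensor2_scale :: "('k \<Rightarrow> 'v \<Rightarrow> 'v) \<Rightarrow> 'k \<Rightarrow> ('v \<times> 'w) list \<Rightarrow> ('v \<times> 'w) list"
  where "tensor2_scale sV c xs = [(sV c x, y). (x, y) \<leftarrow> xs]"

text \<open>The tensor product algebra structure, \<open>(x \<otimes> y)(x' \<otimes> y') = xx' \<otimes> yy'\<close>.\<close>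

definition tensor2_mult ::
  "('v \<Rightarrow> 'v \<Rightarrow> 'v) \<Rightarrow> ('w \<Rightarrow> 'w \<Rightarrow> 'w) \<Rightarrow> ('v \<times> 'w) list \<Rightarrow> ('v \<times> 'w) list \<Rightarrow> ('v \<times> 'w) list"
  where "tensor2_mult mV mW xs ys = [(mV x x', mW y y'). (x, y) \<leftarrow> xs, (x', y') \<leftarrow> ys]"

definition bilinear_map ::
  "('k::field \<Rightarrow> 'v::ab_group_add \<Rightarrow> 'v) \<Rightarrow> ('k \<Rightarrow> 'w::ab_group_add \<Rightarrow> 'w) \<Rightarrow>
    ('k \<Rightarrow> 'u::ab_group_add \<Rightarrow> 'u) \<Rightarrow> ('v \<Rightarrow> 'w \<Rightarrow> 'u) \<Rightarrow> bool"
  where "bilinear_map sV sW sU f \<longleftrightarrow>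
    (\<forall>y. Vector_Spaces.linear sV sU (\<lambda>x. f x y)) \<and>
    (\<forall>x. Vector_Spaces.linear sW sU (\<lambda>y. f x y))"

definition trilinear_map ::
  "('k::field \<Rightarrow> 'v::ab_group_add \<Rightarrow> 'v) \<Rightarrow> ('k \<Rightarrow> 'w::ab_group_add \<Rightarrow> 'w) \<Rightarrow>
    ('k \<Rightarrow> 'u::ab_group_add \<Rightarrow> 'u) \<Rightarrow> ('k \<Rightarrow> 't::ab_group_add \<Rightarrow> 't) \<Rightarrow>
    ('v \<Rightarrow> 'w \<Rightarrow> 'u \<Rightarrow> 't) \<Rightarrow> bool"
  where "trilinear_map sV sW sU sT f \<longleftrightarrow>
    (\<forall>y z. Vector_Spaces.linear sV sT (\<lambda>x. f x y z)) \<and>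
    (\<forall>x z. Vector_Spaces.linear sW sT (\<lambda>y. f x y z)) \<and>
    (\<forall>x y. Vector_Spaces.linear sU sT (\<lambda>z. f x y z))"

lemma tensor2_eq_sum_eq:
  fixes f :: "'v::ab_group_add \<Rightarrow> 'w::ab_group_add \<Rightarrow> 'u::ab_group_add"
  assumes f: "bilinear_map sV sW sU f" and eq: "tensor2_eq sV sW xs ys"
  shows "(\<Sum>(x, y)\<leftarrow>xs. f x y) = (\<Sum>(x, y)\<leftarrow>ys. f x y)"
proof -
  have l: "module_hom sV sU (\<lambda>x. f x y)" "module_hom sW sU (\<lambda>y. f x y)" for x y
    using f by (auto simp: bilinear_map_def Vector_Spaces.linear_def)
  note lin = module_hom.zero[OF l(1)] module_hom.add[OF l(1)] module_hom.add[OF l(2)]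
    module_hom.scale[OF l(1)] module_hom.scale[OF l(2)]
  show ?thesis
    using eq unfolding tensor2_eq_def
    by (induction rule: formal_sum_cong.induct) (auto elim!: bilinear_rel.cases simp: lin add.commute)
qed

lemma tensor3_eq_sum_eq:
  fixes f :: "'v::ab_group_add \<Rightarrow> 'w::ab_group_add \<Rightarrow> 'u::ab_group_add \<Rightarrow> 't::ab_group_add"
  assumes f: "trilinear_map sV sW sU sT f" and eq: "tensor3_eq sV sW sU xs ys"
  shows "(\<Sum>(x, y, z)\<leftarrow>xs. f x y z) = (\<Sum>(x, y, z)\<leftarrow>ys. f x y z)"
proof -
  have l: "module_hom sV sT (\<lambda>x. f x y z)" "module_hom sW sT (\<lambda>y. f x y z)"
    "module_hom sU sT (\<lambda>z. f x y z)" for x y z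
    using f by (auto simp: trilinear_map_def Vector_Spaces.linear_def)
  note lin = module_hom.zero[OF l(1)] module_hom.add[OF l(1)] module_hom.add[OF l(2)]
    module_hom.add[OF l(3)] module_hom.scale[OF l(1)] module_hom.scale[OF l(2)]
    module_hom.scale[OF l(3)]
  show ?thesis
    using eq unfolding tensor3_eq_def
    by (induction rule: formal_sum_cong.induct) (auto elim!: trilinear_rel.cases simp: lin add.commute)
qed


record ('k, 'h) dual_quasi_hopf_data =
  hscale :: "'k \<Rightarrow> 'h \<Rightarrow> 'h"
  comult :: "'h \<Rightarrow> ('h \<times> 'h) list"
  counit :: "'h \<Rightarrow> 'k"
  hmult :: "'h \<Rightarrow> 'h \<Rightarrow> 'h"
  hunit :: "'h"
  reassoc :: "'h \<Rightarrow> 'h \<Rightarrow> 'h \<Rightarrow> 'k"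
  antipode :: "'h \<Rightarrow> 'h"
  alpha :: "'h \<Rightarrow> 'k"
  betaH :: "'h \<Rightarrow> 'k"

locale coalgebra = vector_space "hscale H"
  for H :: "('k::field, 'h::ab_group_add) dual_quasi_hopf_data" +
  assumes comult_add:
      "tensor2_eq (hscale H) (hscale H) (comult H (a + b)) (comult H a @ comult H b)"
    and comult_scale:
      "tensor2_eq (hscale H) (hscale H) (comult H (hscale H c a))
        (tensor2_scale (hscale H) c (comult H a))"
    and counit_linear: "Vector_Spaces.linear (hscale H) (*) (counit H)"
    and coassoc:
      "tensor3_eq (hscale H) (hscale H) (hscale H)
        [(a11, a12, a2). (a1, a2) \<leftarrow> comult H a, (a11, a12) \<leftarrow> comult H a1]
        [(a1, a21, a22). (a1, a2) \<leftarrow> comult H a, (a21, a22) \<leftarrow> comult H a2]"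
    and counit_left: "(\<Sum>(a1, a2)\<leftarrow>comult H a. hscale H (counit H a1) a2) = a"
    and counit_right: "(\<Sum>(a1, a2)\<leftarrow>comult H a. hscale H (counit H a2) a1) = a"

text \<open>Iterated Sweedler legs \<open>a\<^sub>(\<^sub>1\<^sub>) \<otimes> \<dots> \<otimes> a\<^sub>(\<^sub>n\<^sub>)\<close>; by coassociativity the bracketing
  chosen here is immaterial.\<close>

definition comult3 :: "('k, 'h) dual_quasi_hopf_data \<Rightarrow> 'h \<Rightarrow> ('h \<times> 'h \<times> 'h) list"
  where "comult3 H a = [(a1, a2, a3). (a1, r) \<leftarrow> comult H a, (a2, a3) \<leftarrow> comult H r]"

definition comult4 :: "('k, 'h) dual_quasi_hopf_data \<Rightarrow> 'h \<Rightarrow> ('h \<times> 'h \<times> 'h \<times> 'h) list"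
  where "comult4 H a = [(a1, a2, a3, a4). (a1, r) \<leftarrow> comult H a, (a2, a3, a4) \<leftarrow> comult3 H r]"

definition comult5 :: "('k, 'h) dual_quasi_hopf_data \<Rightarrow> 'h \<Rightarrow> ('h \<times> 'h \<times> 'h \<times> 'h \<times> 'h) list"
  where "comult5 H a =
    [(a1, a2, a3, a4, a5). (a1, r) \<leftarrow> comult H a, (a2, a3, a4, a5) \<leftarrow> comult4 H r]"

text \<open>Convolution inverses in the duals of \<open>H \<otimes> H\<close> and \<open>H \<otimes> H \<otimes> H\<close>. They are unique when \<open>H\<close> is
  a coalgebra, which justifies the definite descriptions.\<close>

definition is_conv_inverse2 ::
  "('k::field, 'h::ab_group_add) dual_quasi_hopf_data \<Rightarrow> ('h \<Rightarrow> 'h \<Rightarrow> 'k) \<Rightarrow> ('h \<Rightarrow> 'h \<Rightarrow> 'k) \<Rightarrow> bool"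
  where "is_conv_inverse2 H F G \<longleftrightarrow>
    bilinear_map (hscale H) (hscale H) (*) G \<and>
    (\<forall>a b. (\<Sum>(a1, a2)\<leftarrow>comult H a. \<Sum>(b1, b2)\<leftarrow>comult H b. F a1 b1 * G a2 b2)
        = counit H a * counit H b) \<and>
    (\<forall>a b. (\<Sum>(a1, a2)\<leftarrow>comult H a. \<Sum>(b1, b2)\<leftarrow>comult H b. G a1 b1 * F a2 b2)
        = counit H a * counit H b)"

definition conv_inverse2 ::
  "('k::field, 'h::ab_group_add) dual_quasi_hopf_data \<Rightarrow> ('h \<Rightarrow> 'h \<Rightarrow> 'k) \<Rightarrow> 'h \<Rightarrow> 'h \<Rightarrow> 'k"
  where "conv_inverse2 H F = (THE G. is_conv_inverse2 H F G)"

definition is_conv_inverse3 ::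
  "('k::field, 'h::ab_group_add) dual_quasi_hopf_data \<Rightarrow>
    ('h \<Rightarrow> 'h \<Rightarrow> 'h \<Rightarrow> 'k) \<Rightarrow> ('h \<Rightarrow> 'h \<Rightarrow> 'h \<Rightarrow> 'k) \<Rightarrow> bool"
  where "is_conv_inverse3 H \<phi> \<psi> \<longleftrightarrow>
    trilinear_map (hscale H) (hscale H) (hscale H) (*) \<psi> \<and>
    (\<forall>a b c. (\<Sum>(a1, a2)\<leftarrow>comult H a. \<Sum>(b1, b2)\<leftarrow>comult H b. \<Sum>(c1, c2)\<leftarrow>comult H c.
        \<phi> a1 b1 c1 * \<psi> a2 b2 c2) = counit H a * counit H b * counit H c) \<and>
    (\<forall>a b c. (\<Sum>(a1, a2)\<leftarrow>comult H a. \<Sum>(b1, b2)\<leftarrow>comult H b. \<Sum>(c1, c2)\<leftarrow>comult H c.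
        \<psi> a1 b1 c1 * \<phi> a2 b2 c2) = counit H a * counit H b * counit H c)"

definition conv_inverse3 ::
  "('k::field, 'h::ab_group_add) dual_quasi_hopf_data \<Rightarrow>
    ('h \<Rightarrow> 'h \<Rightarrow> 'h \<Rightarrow> 'k) \<Rightarrow> 'h \<Rightarrow> 'h \<Rightarrow> 'h \<Rightarrow> 'k"
  where "conv_inverse3 H \<phi> = (THE \<psi>. is_conv_inverse3 H \<phi> \<psi>)"

locale dual_quasibialgebra = coalgebra H
  for H :: "('k::field, 'h::ab_group_add) dual_quasi_hopf_data" +
  assumes hmult_bilinear: "bilinear_map (hscale H) (hscale H) (hscale H) (hmult H)"
    and hunit_left: "hmult H (hunit H) a = a"
    and hunit_right: "hmult H a (hunit H) = a"
    and comult_hmult: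
      "tensor2_eq (hscale H) (hscale H) (comult H (hmult H a b))
        (tensor2_mult (hmult H) (hmult H) (comult H a) (comult H b))"
    and comult_hunit:
      "tensor2_eq (hscale H) (hscale H) (comult H (hunit H)) [(hunit H, hunit H)]"
    and counit_hmult: "counit H (hmult H a b) = counit H a * counit H b"
    and counit_hunit: "counit H (hunit H) = 1"
    and reassoc_trilinear:
      "trilinear_map (hscale H) (hscale H) (hscale H) (*) (reassoc H)"
    and reassoc_invertible: "\<exists>\<psi>. is_conv_inverse3 H (reassoc H) \<psi>"
    and quasi_assoc:
      "(\<Sum>(a1, a2)\<leftarrow>comult H a. \<Sum>(b1, b2)\<leftarrow>comult H b. \<Sum>(c1, c2)\<leftarrow>comult H c.
          hscale H (reassoc H a2 b2 c2) (hmult H a1 (hmult H b1 c1)))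
        = (\<Sum>(a1, a2)\<leftarrow>comult H a. \<Sum>(b1, b2)\<leftarrow>comult H b. \<Sum>(c1, c2)\<leftarrow>comult H c.
          hscale H (reassoc H a1 b1 c1) (hmult H (hmult H a2 b2) c2))"
    and reassoc_cocycle:
      "(\<Sum>(a1, a2)\<leftarrow>comult H a. \<Sum>(b1, b2, b3)\<leftarrow>comult3 H b.
          \<Sum>(c1, c2, c3)\<leftarrow>comult3 H c. \<Sum>(d1, d2)\<leftarrow>comult H d.
          reassoc H b1 c1 d1 * reassoc H a1 (hmult H b2 c2) d2 * reassoc H a2 b3 c3)
        = (\<Sum>(a1, a2)\<leftarrow>comult H a. \<Sum>(b1, b2)\<leftarrow>comult H b.
          \<Sum>(c1, c2)\<leftarrow>comult H c. \<Sum>(d1, d2)\<leftarrow>comult H d.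
          reassoc H a1 b1 (hmult H c1 d1) * reassoc H (hmult H a2 b2) c2 d2)"
    and reassoc_hunit: "reassoc H a (hunit H) b = counit H a * counit H b"

locale dual_quasi_hopf_algebra = dual_quasibialgebra H
  for H :: "('k::field, 'h::ab_group_add) dual_quasi_hopf_data" +
  assumes antipode_linear: "Vector_Spaces.linear (hscale H) (hscale H) (antipode H)"
    and alpha_linear: "Vector_Spaces.linear (hscale H) (*) (alpha H)"
    and betaH_linear: "Vector_Spaces.linear (hscale H) (*) (betaH H)"
    and antipode_alpha:
      "(\<Sum>(a1, a2, a3)\<leftarrow>comult3 H a. hscale H (alpha H a2) (hmult H (antipode H a1) a3))
        = hscale H (alpha H a) (hunit H)"
    and antipode_betaH:
      "(\<Sum>(a1, a2, a3)\<leftarrow>comult3 H a. hscale H (betaH H a2) (hmult H a1 (antipode H a3)))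
        = hscale H (betaH H a) (hunit H)"
    and antipode_reassoc:
      "(\<Sum>(a1, a2, a3, a4, a5)\<leftarrow>comult5 H a.
          reassoc H a1 (antipode H a3) a5 * betaH H a2 * alpha H a4) = counit H a"
    and antipode_reassoc_inverse:
      "(\<Sum>(a1, a2, a3, a4, a5)\<leftarrow>comult5 H a.
          conv_inverse3 H (reassoc H) (antipode H a1) a3 (antipode H a5)
            * alpha H a2 * betaH H a4) = counit H a"

definition cochain2 ::
  "('k::field, 'h::ab_group_add) dual_quasi_hopf_data \<Rightarrow> ('h \<Rightarrow> 'h \<Rightarrow> 'k) \<Rightarrow> bool"
  where "cochain2 H F \<longleftrightarrow>
    bilinear_map (hscale H) (hscale H) (*) F \<and>
    (\<exists>G. is_conv_inverse2 H F G) \<and>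
    (\<forall>a. F a (hunit H) = counit H a \<and> F (hunit H) a = counit H a)"

definition twist ::
  "('k::field, 'h::ab_group_add) dual_quasi_hopf_data \<Rightarrow> ('h \<Rightarrow> 'h \<Rightarrow> 'k) \<Rightarrow>
    ('k, 'h) dual_quasi_hopf_data"
  where "twist H F = H\<lparr>
    hmult := (\<lambda>a b. \<Sum>(a1, a2, a3)\<leftarrow>comult3 H a. \<Sum>(b1, b2, b3)\<leftarrow>comult3 H b.
      hscale H (conv_inverse2 H F a1 b1 * F a3 b3) (hmult H a2 b2)),
    reassoc := (\<lambda>a b c. \<Sum>(a1, a2, a3, a4)\<leftarrow>comult4 H a.
      \<Sum>(b1, b2, b3, b4, b5)\<leftarrow>comult5 H b. \<Sum>(c1, c2, c3, c4)\<leftarrow>comult4 H c.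
      conv_inverse2 H F b1 c1 * conv_inverse2 H F a1 (hmult H b2 c2) * reassoc H a2 b3 c3
        * F (hmult H a3 b4) c4 * F a4 b5),
    alpha := (\<lambda>a. \<Sum>(a1, a2, a3)\<leftarrow>comult3 H a. F (antipode H a1) a3 * alpha H a2),
    betaH := (\<lambda>a. \<Sum>(a1, a2, a3)\<leftarrow>comult3 H a.
      conv_inverse2 H F a1 (antipode H a3) * betaH H a2)\<rparr>"


record ('k, 'h, 'a) comodule_algebra_data =
  ascale :: "'k \<Rightarrow> 'a \<Rightarrow> 'a"
  coact :: "'a \<Rightarrow> ('a \<times> 'h) list"
  amult :: "'a \<Rightarrow> 'a \<Rightarrow> 'a"
  aunit :: "'a"

locale right_comodule = vector_space "ascale A"
  for H :: "('k::field, 'h::ab_group_add) dual_quasi_hopf_data"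
    and A :: "('k, 'h, 'a::ab_group_add) comodule_algebra_data" +
  assumes coact_add:
      "tensor2_eq (ascale A) (hscale H) (coact A (a + b)) (coact A a @ coact A b)"
    and coact_scale:
      "tensor2_eq (ascale A) (hscale H) (coact A (ascale A c a))
        (tensor2_scale (ascale A) c (coact A a))"
    and coact_coassoc:
      "tensor3_eq (ascale A) (hscale H) (hscale H)
        [(a00, a01, a1). (a0, a1) \<leftarrow> coact A a, (a00, a01) \<leftarrow> coact A a0]
        [(a0, a11, a12). (a0, a1) \<leftarrow> coact A a, (a11, a12) \<leftarrow> comult H a1]"
    and coact_counit: "(\<Sum>(a0, a1)\<leftarrow>coact A a. ascale A (counit H a1) a0) = a"

locale comodule_quasialgebra = right_comodule H A
  for H :: "('k::field, 'h::ab_group_add) dual_quasi_hopf_data"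
    and A :: "('k, 'h, 'a::ab_group_add) comodule_algebra_data" +
  assumes amult_bilinear: "bilinear_map (ascale A) (ascale A) (ascale A) (amult A)"
    and aunit_left: "amult A (aunit A) a = a"
    and aunit_right: "amult A a (aunit A) = a"
    and amult_quasi_assoc:
      "amult A (amult A a b) c =
        (\<Sum>(a0, a1)\<leftarrow>coact A a. \<Sum>(b0, b1)\<leftarrow>coact A b. \<Sum>(c0, c1)\<leftarrow>coact A c.
          ascale A (reassoc H a1 b1 c1) (amult A a0 (amult A b0 c0)))"
    and coact_amult:
      "tensor2_eq (ascale A) (hscale H) (coact A (amult A a b))
        (tensor2_mult (amult A) (hmult H) (coact A a) (coact A b))"
    and coact_aunit:
      "tensor2_eq (ascale A) (hscale H) (coact A (aunit A)) [(aunit A, hunit H)]"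

definition twist_comodule_algebra ::
  "('k::field, 'h, 'a::ab_group_add) comodule_algebra_data \<Rightarrow> ('h \<Rightarrow> 'h \<Rightarrow> 'k) \<Rightarrow>
    ('k, 'h, 'a) comodule_algebra_data"
  where "twist_comodule_algebra A F = A\<lparr>
    amult := (\<lambda>a b. \<Sum>(a0, a1)\<leftarrow>coact A a. \<Sum>(b0, b1)\<leftarrow>coact A b.
      ascale A (F a1 b1) (amult A a0 b0))\<rparr>"

end

theory Submission
  imports Defs
begin

text \<open>
  The bilinear maps out of \<open>A \<times> A\<close> (and the trilinear ones out of \<open>A \<times> A \<times> A\<close>) form a right module over
  the convolution algebra of bilinear (trilinear) functionals on \<open>H\<close>: write
  \<open>(M \<triangleleft> P) a b = \<Sum> M a\<^sub>0 b\<^sub>0 P(a\<^sub>1, b\<^sub>1)\<close>. That \<open>(M \<triangleleft> P) \<triangleleft> Q = M \<triangleleft> (P * Q)\<close> and that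
  the counit acts as the identity is just coassociativity and counitality of the coaction
  (\<open>act2_act2\<close>, \<open>act3_act3\<close>, \<open>act2_counit\<close>). In this language, with \<open>m\<close> the product of \<open>A\<close> and \<open>\<mu>\<close>
  that of \<open>H\<close>, the twisted product is \<open>m\<^sub>F = m \<triangleleft> F\<close>, and every axiom becomes a short computation in
  a module over a monoid.

  Quasi-associativity: put \<open>T a b c = a(bc)\<close>, so that quasi-associativity of \<open>A\<close> reads
  \<open>(ab)c = (T \<triangleleft> \<phi>) a b c\<close>. Since the coaction is multiplicative, the two iterated twisted products are
  \<open>m\<^sub>F(m\<^sub>F \<otimes> 1) = T \<triangleleft> \<phi> \<triangleleft> F(\<mu> \<otimes> 1) \<triangleleft> (F \<otimes> \<epsilon>)\<close> and
  \<open>m\<^sub>F(1 \<otimes> m\<^sub>F) = T \<triangleleft> F(1 \<otimes> \<mu>) \<triangleleft> (\<epsilon> \<otimes> F)\<close>, while the twisted reassociator is the convolution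
  product of the inverse of \<open>\<epsilon> \<otimes> F\<close>, the inverse of \<open>F(1 \<otimes> \<mu>)\<close>, \<open>\<phi>\<close>, \<open>F(\<mu> \<otimes> 1)\<close> and \<open>F \<otimes> \<epsilon>\<close> in this order
  (\<open>twisted_reassoc\<close>). Acting with it on the second expression cancels the first two factors and
  leaves the first expression (\<open>twisted_quasi_assoc\<close>).

  Multiplicativity of the coaction is an equality of tensors in \<open>A \<otimes> H\<close>. Over a field it may be tested
  by applying linear functionals \<open>g\<close> to the factor \<open>H\<close> (\<open>tensor2_eq_if_functionals_eq\<close>). Both sides
  then turn out to be \<open>m \<triangleleft> (g\<mu> * F)\<close>: the right-hand side is \<open>m\<^sub>F \<triangleleft> g\<mu>\<^sub>F\<close> with \<open>\<mu>\<^sub>F\<close> the twisted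
  product, and \<open>g\<mu>\<^sub>F\<close> is the conjugate \<open>F\<^sup>- * g\<mu> * F\<close> by the convolution inverse \<open>F\<^sup>-\<close> of \<open>F\<close>
  (\<open>twisted_coact_amult\<close>). The unit of \<open>A\<close> remains a unit for \<open>m\<^sub>F\<close> because \<open>F\<close> is
  normalised.
\<close>

section \<open>Linearity of sums over formal tensors\<close>

lemma sum_list_concat_map:
  "(\<Sum>z\<leftarrow>concat (map g xs). f z) = (\<Sum>x\<leftarrow>xs. \<Sum>z\<leftarrow>g x. (f z :: 'b::comm_monoid_add))"
  by (induction xs) auto

lemma sum_list_commute:
  "(\<Sum>x\<leftarrow>xs. \<Sum>y\<leftarrow>ys. f x y) = (\<Sum>y\<leftarrow>ys. \<Sum>x\<leftarrow>xs. (f x y :: 'b::comm_monoid_add))"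
  by (induction xs) (auto simp: sum_list_addf)

lemma sum_list_pair_commute:
  "(\<Sum>(x, x')\<leftarrow>xs. \<Sum>(y, y')\<leftarrow>ys. f x x' y y')
    = (\<Sum>(y, y')\<leftarrow>ys. \<Sum>(x, x')\<leftarrow>xs. (f x x' y y' :: 'b::comm_monoid_add))"
  unfolding case_prod_unfold by (rule sum_list_commute)

lemma sum_list_pair_cong:
  "(\<And>u v. f u v = g u v) \<Longrightarrow> (\<Sum>(u, v)\<leftarrow>xs. f u v) = (\<Sum>(u, v)\<leftarrow>xs. (g u v :: 'b::comm_monoid_add))"
  by presburger

lemma linear_ident: "vector_space s \<Longrightarrow> Vector_Spaces.linear s s (\<lambda>x. x)"
  by (auto simp: Vector_Spaces.linear_iff)

lemma linear_scale_coeff: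
  "vector_space t \<Longrightarrow> Vector_Spaces.linear s (*) f \<Longrightarrow> Vector_Spaces.linear s t (\<lambda>x. t (f x) v)"
  by (auto simp: Vector_Spaces.linear_iff vector_space_def module_def)

lemma linear_scale_right:
  "Vector_Spaces.linear s t f \<Longrightarrow> Vector_Spaces.linear s t (\<lambda>x. t c (f x))"
  by (auto simp: Vector_Spaces.linear_iff vector_space_def module_def mult.commute)

lemma linear_sum_list:
  assumes "\<And>u v. Vector_Spaces.linear s t (\<lambda>x. f x u v)"
  shows "Vector_Spaces.linear s t (\<lambda>x. \<Sum>(u, v)\<leftarrow>xs. f x u v)"
proof -
  have "vector_space s" "vector_space t"
    using assms by (auto simp: Vector_Spaces.linear_iff)
  then interpret s: vector_space s + t: vector_space t by auto
  show ?thesis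
    using assms
    by (induction xs) (auto simp: Vector_Spaces.linear_iff add_ac t.scale_right_distrib)
qed

lemma linear_apply_sum:
  assumes "Vector_Spaces.linear s t f"
  shows "f (\<Sum>x\<leftarrow>xs. g x) = (\<Sum>x\<leftarrow>xs. f (g x))"
proof -
  interpret f: Vector_Spaces.linear s t f by fact
  show ?thesis by (induction xs) (auto simp: f.zero f.add)
qed

lemma linear_apply_sum_list:
  assumes "Vector_Spaces.linear s t f"
  shows "f (\<Sum>(u, v)\<leftarrow>xs. g u v) = (\<Sum>(u, v)\<leftarrow>xs. f (g u v))"
  by (simp add: linear_apply_sum[OF assms] case_prod_unfold)

lemma linear_comp:
  "Vector_Spaces.linear s t f \<Longrightarrow> Vector_Spaces.linear r s g \<Longrightarrow> Vector_Spaces.linear r t (\<lambda>x. f (g x))"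
  by (auto simp: Vector_Spaces.linear_iff)

lemma bilinear_left:
  "bilinear_map s1 s2 t m \<Longrightarrow> Vector_Spaces.linear s s1 f \<Longrightarrow> Vector_Spaces.linear s t (\<lambda>x. m (f x) y)"
  unfolding bilinear_map_def by (auto simp: Vector_Spaces.linear_iff)

lemma bilinear_right:
  "bilinear_map s1 s2 t m \<Longrightarrow> Vector_Spaces.linear s s2 f \<Longrightarrow> Vector_Spaces.linear s t (\<lambda>y. m x (f y))"
  unfolding bilinear_map_def by (auto simp: Vector_Spaces.linear_iff)

lemma trilinear_1:
  "trilinear_map s1 s2 s3 t m \<Longrightarrow> Vector_Spaces.linear s s1 f \<Longrightarrow> Vector_Spaces.linear s t (\<lambda>x. m (f x) y z)"
  unfolding trilinear_map_def by (auto simp: Vector_Spaces.linear_iff)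

lemma trilinear_2:
  "trilinear_map s1 s2 s3 t m \<Longrightarrow> Vector_Spaces.linear s s2 f \<Longrightarrow> Vector_Spaces.linear s t (\<lambda>y. m x (f y) z)"
  unfolding trilinear_map_def by (auto simp: Vector_Spaces.linear_iff)

lemma trilinear_3:
  "trilinear_map s1 s2 s3 t m \<Longrightarrow> Vector_Spaces.linear s s3 f \<Longrightarrow> Vector_Spaces.linear s t (\<lambda>z. m x y (f z))"
  unfolding trilinear_map_def by (auto simp: Vector_Spaces.linear_iff)

lemma vector_space_field: "vector_space ((*) :: 'k::field \<Rightarrow> 'k \<Rightarrow> 'k)"
  by unfold_locales (auto simp: algebra_simps)

lemma trilinear_nest_left:
  assumes N: "bilinear_map r u t N" and M: "bilinear_map s s' r M"
  shows "trilinear_map s s' u t (\<lambda>a b c. N (M a b) c)"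
proof -
  have "vector_space s" "vector_space s'" "vector_space u"
    using N M by (auto simp: bilinear_map_def Vector_Spaces.linear_iff)
  then show ?thesis
    unfolding trilinear_map_def
    by (auto intro!: bilinear_left[OF N] bilinear_right[OF N] bilinear_left[OF M] bilinear_right[OF M] linear_ident)
qed

lemma trilinear_nest_right:
  assumes N: "bilinear_map u r t N" and M: "bilinear_map s s' r M"
  shows "trilinear_map u s s' t (\<lambda>a b c. N a (M b c))"
proof -
  have "vector_space s" "vector_space s'" "vector_space u"
    using N M by (auto simp: bilinear_map_def Vector_Spaces.linear_iff)
  then show ?thesis
    unfolding trilinear_map_def
    by (auto intro!: bilinear_left[OF N] bilinear_right[OF N] bilinear_left[OF M] bilinear_right[OF M] linear_ident)
qed

lemma bilinear_linear_comp:
  assumes g: "Vector_Spaces.linear t u g" and M: "bilinear_map s s' t M"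
  shows "bilinear_map s s' u (\<lambda>a b. g (M a b))"
  using M unfolding bilinear_map_def by (auto intro: linear_comp[OF g])

section \<open>Tensors are separated by linear functionals\<close>

context
  fixes sV :: "'k::field \<Rightarrow> 'v::ab_group_add \<Rightarrow> 'v" and sW :: "'k \<Rightarrow> 'w::ab_group_add \<Rightarrow> 'w"
  assumes V: "vector_space sV" and W: "vector_space sW"
begin

interpretation V: vector_space sV by (rule V)
interpretation W: vector_space sW by (rule W)

lemma tensor2_rel: "bilinear_rel sV sW xs ys \<Longrightarrow> tensor2_eq sV sW xs ys"
  unfolding tensor2_eq_def by (rule formal_sum_cong.rel)

lemma tensor2_refl: "tensor2_eq sV sW xs xs"
  unfolding tensor2_eq_def by (rule formal_sum_cong.refl)

lemma tensor2_sym: "tensor2_eq sV sW xs ys \<Longrightarrow> tensor2_eq sV sW ys xs"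
  unfolding tensor2_eq_def by (rule formal_sum_cong.sym)

lemma tensor2_trans [trans]:
  "tensor2_eq sV sW xs ys \<Longrightarrow> tensor2_eq sV sW ys zs \<Longrightarrow> tensor2_eq sV sW xs zs"
  unfolding tensor2_eq_def by (rule formal_sum_cong.trans)

lemma tensor2_app:
  "tensor2_eq sV sW xs xs' \<Longrightarrow> tensor2_eq sV sW ys ys' \<Longrightarrow> tensor2_eq sV sW (xs @ ys) (xs' @ ys')"
  unfolding tensor2_eq_def by (rule formal_sum_cong.app)

lemma tensor2_comm: "tensor2_eq sV sW (xs @ ys) (ys @ xs)"
  unfolding tensor2_eq_def by (rule formal_sum_cong.comm)

lemma tensor2_zero: "tensor2_eq sV sW (map (\<lambda>b. (0, b)) bs) []"
proof (induction bs)
  case (Cons b bs)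
  show ?case
    using tensor2_app[OF tensor2_rel[OF bilinear_rel.intros(1)] Cons, of b] by simp
qed (simp add: tensor2_refl)

lemma tensor2_add:
  "tensor2_eq sV sW (map (\<lambda>b. (u b, b)) bs @ map (\<lambda>b. (w b, b)) bs) (map (\<lambda>b. (u b + w b, b)) bs)"
proof (induction bs)
  case (Cons b bs)
  let ?us = "map (\<lambda>b. (u b, b)) bs" and ?ws = "map (\<lambda>b. (w b, b)) bs"
  have "tensor2_eq sV sW ([(u b, b)] @ (?us @ [(w b, b)]) @ ?ws) ([(u b, b)] @ ([(w b, b)] @ ?us) @ ?ws)"
    by (intro tensor2_app tensor2_refl tensor2_comm)
  also have "[(u b, b)] @ ([(w b, b)] @ ?us) @ ?ws = [(u b, b), (w b, b)] @ (?us @ ?ws)"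
    by simp
  also have "tensor2_eq sV sW \<dots> ([(u b + w b, b)] @ map (\<lambda>b. (u b + w b, b)) bs)"
    by (intro tensor2_app Cons tensor2_sym[OF tensor2_rel] bilinear_rel.intros)
  finally show ?case by simp
qed (simp add: tensor2_refl)

lemma tensor2_sum_right:
  "tensor2_eq sV sW [(x, \<Sum>b\<leftarrow>bs. sW (c b) b)] (map (\<lambda>b. (sV (c b) x, b)) bs)"
proof (induction bs)
  case Nil
  have "tensor2_eq sV sW [(x, sW 0 0)] [(sV 0 x, 0)]"
    by (intro tensor2_sym[OF tensor2_rel] bilinear_rel.intros)
  also have "tensor2_eq sV sW [(sV 0 x, 0)] []"
    using tensor2_rel[OF bilinear_rel.intros(1)] by simp
  finally show ?case by simp
next
  case (Cons b bs)
  let ?y = "\<Sum>b\<leftarrow>bs. sW (c b) b"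
  have "tensor2_eq sV sW [(x, sW (c b) b + ?y)] ([(x, sW (c b) b)] @ [(x, ?y)])"
    by (simp, intro tensor2_rel bilinear_rel.intros)
  also have "tensor2_eq sV sW \<dots> ([(sV (c b) x, b)] @ map (\<lambda>b. (sV (c b) x, b)) bs)"
    by (intro tensor2_app Cons tensor2_sym[OF tensor2_rel] bilinear_rel.intros)
  finally show ?case by simp
qed

text \<open>
  Expanding the second components in a basis of \<open>W\<close> brings every formal sum into the normal form
  \<open>\<Sum>\<^sub>b v\<^sub>b \<otimes> b\<close>, and the coefficients \<open>v\<^sub>b\<close> are the values of the coordinate functionals. So
  functionals on one factor separate tensors.
\<close>

lemma tensor2_eq_if_functionals_eq:
  assumes eq: "\<And>g. Vector_Spaces.linear sW (*) g \<Longrightarrow>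
      (\<Sum>(x, y)\<leftarrow>xs. sV (g y) x) = (\<Sum>(x, y)\<leftarrow>ys. sV (g y) x)"
  shows "tensor2_eq sV sW xs ys"
proof -
  obtain B where B: "W.independent B" "W.span B = UNIV"
    by (metis W.basis_exists top.extremum_unique)
  define r where "r = W.representation B"
  \<comment> \<open>The basis vectors that occur in either formal sum, so that one list serves for both normal forms.\<close>
  define S where "S = (\<Union>y\<in>set (map snd (xs @ ys)). {b. r y b \<noteq> 0})"
  have "finite S" unfolding S_def r_def by (auto intro: W.finite_representation)
  then obtain bs where bs: "set bs = S" "distinct bs" by (metis finite_distinct_list)
  have expand: "y = (\<Sum>b\<leftarrow>bs. sW (r y b) b)" if "y \<in> snd ` set (xs @ ys)" for y
  proof -
    have "y = (\<Sum>b\<in>{b. r y b \<noteq> 0}. sW (r y b) b)"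
      unfolding r_def using W.sum_nonzero_representation_eq[OF B(1)] B(2) by auto
    also have "\<dots> = (\<Sum>b\<in>set bs. sW (r y b) b)"
    proof (rule sum.mono_neutral_left)
      show "{b. r y b \<noteq> 0} \<subseteq> set bs" using that unfolding bs S_def by auto
    qed (auto simp: bs \<open>finite S\<close>)
    finally show ?thesis using bs(2) by (simp add: sum_list_distinct_conv_sum_set)
  qed
  have normal: "tensor2_eq sV sW zs (map (\<lambda>b. (\<Sum>(x, y)\<leftarrow>zs. sV (r y b) x, b)) bs)"
    if "set zs \<subseteq> set (xs @ ys)" for zs
    using that
  proof (induction zs)
    case Nil
    show ?case using tensor2_sym[OF tensor2_zero] by simp
  next
    case (Cons z zs)
    obtain x y where z: "z = (x, y)" by force
    let ?u = "\<lambda>b. sV (r y b) x" and ?w = "\<lambda>b. \<Sum>(x, y)\<leftarrow>zs. sV (r y b) x"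
    have "y = (\<Sum>b\<leftarrow>bs. sW (r y b) b)" using Cons.prems z by (intro expand) force
    then have "tensor2_eq sV sW [(x, y)] (map (\<lambda>b. (?u b, b)) bs)"
      using tensor2_sum_right[of x "r y" bs] by simp
    then have "tensor2_eq sV sW ([(x, y)] @ zs) (map (\<lambda>b. (?u b, b)) bs @ map (\<lambda>b. (?w b, b)) bs)"
      using Cons by (intro tensor2_app) auto
    also have "tensor2_eq sV sW \<dots> (map (\<lambda>b. (?u b + ?w b, b)) bs)" by (rule tensor2_add)
    finally show ?case by (simp add: z)
  qed
  have "Vector_Spaces.linear sW (*) (\<lambda>y. r y b)" for b
    using W.representation_add[OF B(1)] W.representation_scale[OF B(1)] B(2) W vector_space_field
    by (simp add: Vector_Spaces.linear_iff r_def)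
  then have "(\<Sum>(x, y)\<leftarrow>xs. sV (r y b) x) = (\<Sum>(x, y)\<leftarrow>ys. sV (r y b) x)" for b
    by (rule eq)
  then show ?thesis
    using normal[of xs] tensor2_sym[OF normal[of ys]] tensor2_trans by force
qed

end

section \<open>Multilinear maps as a module over convolution algebras\<close>

text \<open>
  The right action of the convolution algebra of functionals \<open>P\<close> on multilinear maps \<open>M\<close>. The target of
  \<open>M\<close> is an arbitrary vector space with scalar multiplication \<open>s\<close>: for \<open>H\<close> coacting on itself and
  scalar-valued \<open>M\<close> the action is the convolution product itself, so all facts about the action
  also hold for convolution.
\<close>

definition act2 ::
  "('k, 'h, 'a) comodule_algebra_data \<Rightarrow> ('k \<Rightarrow> 'v \<Rightarrow> 'v::ab_group_add) \<Rightarrow>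
    ('a \<Rightarrow> 'a \<Rightarrow> 'v) \<Rightarrow> ('h \<Rightarrow> 'h \<Rightarrow> 'k) \<Rightarrow> 'a \<Rightarrow> 'a \<Rightarrow> 'v"
  where "act2 A s M P a b =
    (\<Sum>(a0, a1)\<leftarrow>coact A a. \<Sum>(b0, b1)\<leftarrow>coact A b. s (P a1 b1) (M a0 b0))"

definition act3 ::
  "('k, 'h, 'a) comodule_algebra_data \<Rightarrow> ('k \<Rightarrow> 'v \<Rightarrow> 'v::ab_group_add) \<Rightarrow>
    ('a \<Rightarrow> 'a \<Rightarrow> 'a \<Rightarrow> 'v) \<Rightarrow> ('h \<Rightarrow> 'h \<Rightarrow> 'h \<Rightarrow> 'k) \<Rightarrow> 'a \<Rightarrow> 'a \<Rightarrow> 'a \<Rightarrow> 'v"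
  where "act3 A s M P a b c =
    (\<Sum>(a0, a1)\<leftarrow>coact A a. \<Sum>(b0, b1)\<leftarrow>coact A b. \<Sum>(c0, c1)\<leftarrow>coact A c.
      s (P a1 b1 c1) (M a0 b0 c0))"

definition regular ::
  "('k, 'h) dual_quasi_hopf_data \<Rightarrow> ('k, 'h, 'h) comodule_algebra_data"
  where "regular H = \<lparr>ascale = hscale H, coact = comult H, amult = hmult H, aunit = hunit H\<rparr>"

lemma regular_simps [simp]:
  "ascale (regular H) = hscale H" "coact (regular H) = comult H"
  "amult (regular H) = hmult H" "aunit (regular H) = hunit H"
  by (simp_all add: regular_def)

abbreviation conv2 ::
  "('k::field, 'h) dual_quasi_hopf_data \<Rightarrow> ('h \<Rightarrow> 'h \<Rightarrow> 'k) \<Rightarrow> ('h \<Rightarrow> 'h \<Rightarrow> 'k) \<Rightarrow> 'h \<Rightarrow> 'h \<Rightarrow> 'k"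
  where "conv2 H \<equiv> act2 (regular H) (*)"

abbreviation conv3 ::
  "('k::field, 'h) dual_quasi_hopf_data \<Rightarrow> ('h \<Rightarrow> 'h \<Rightarrow> 'h \<Rightarrow> 'k) \<Rightarrow> ('h \<Rightarrow> 'h \<Rightarrow> 'h \<Rightarrow> 'k) \<Rightarrow>
    'h \<Rightarrow> 'h \<Rightarrow> 'h \<Rightarrow> 'k"
  where "conv3 H \<equiv> act3 (regular H) (*)"

locale coalgebra_comodule = C: coalgebra H + M: right_comodule H A
  for H :: "('k::field, 'h::ab_group_add) dual_quasi_hopf_data"
    and A :: "('k, 'h, 'a::ab_group_add) comodule_algebra_data"
begin

text \<open>
  The coaction is linear only up to equality of tensors; once its legs are fed to a bilinear map, this
  becomes honest linearity. The curried hypotheses let the lemma act as a syntax-directed rule, so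
  that linearity of a whole nested Sweedler sum in one variable follows from \<open>linear_intros\<close> below.
\<close>

lemma linear_coact:
  assumes u: "\<And>y. Vector_Spaces.linear (ascale A) t (\<lambda>x. f x y)"
    and v: "\<And>x. Vector_Spaces.linear (hscale H) t (\<lambda>y. f x y)"
  shows "Vector_Spaces.linear (ascale A) t (\<lambda>a. \<Sum>(x, y)\<leftarrow>coact A a. f x y)"
proof -
  have f: "bilinear_map (ascale A) (hscale H) t f" using u v by (simp add: bilinear_map_def)
  have t: "vector_space t" using u by (simp add: Vector_Spaces.linear_iff)
  interpret u: Vector_Spaces.linear "ascale A" t "\<lambda>x. f x y" for y by (rule u)
  have scale: "(\<Sum>(x, y)\<leftarrow>tensor2_scale (ascale A) c xs. f x y) = t c (\<Sum>(x, y)\<leftarrow>xs. f x y)" for c xs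
    by (induction xs)
      (auto simp: tensor2_scale_def u.scale u.vs2.scale_right_distrib)
  show ?thesis
    using t M.vector_space_axioms tensor2_eq_sum_eq[OF f M.coact_add] tensor2_eq_sum_eq[OF f M.coact_scale]
    by (simp add: Vector_Spaces.linear_iff scale)
qed

lemma coact_coassoc_sum:
  assumes "trilinear_map (ascale A) (hscale H) (hscale H) t f"
  shows "(\<Sum>(a0, a1)\<leftarrow>coact A a. \<Sum>(a00, a01)\<leftarrow>coact A a0. f a00 a01 a1)
    = (\<Sum>(a0, a1)\<leftarrow>coact A a. \<Sum>(a11, a12)\<leftarrow>comult H a1. f a0 a11 a12)"
  using tensor3_eq_sum_eq[OF assms M.coact_coassoc[of a]]
  by (simp add: sum_list_concat_map case_prod_unfold comp_def)

lemma coact_counit_apply: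
  assumes f: "Vector_Spaces.linear (ascale A) t f"
  shows "(\<Sum>(a0, a1)\<leftarrow>coact A a. t (counit H a1) (f a0)) = f a"
proof -
  interpret f: Vector_Spaces.linear "ascale A" t f by (rule f)
  have "f a = f (\<Sum>(a0, a1)\<leftarrow>coact A a. ascale A (counit H a1) a0)" by (simp add: M.coact_counit)
  also have "\<dots> = (\<Sum>(a0, a1)\<leftarrow>coact A a. t (counit H a1) (f a0))"
    by (simp add: linear_apply_sum_list[OF f] f.scale)
  finally show ?thesis by simp
qed

end

lemma (in coalgebra) regular_comodule: "right_comodule H (regular H)"
  by (intro_locales, simp_all only: regular_simps vector_space_axioms vector_space_def[symmetric])
    (unfold right_comodule_axioms_def regular_simps, intro conjI allI comult_add comult_scale coassoc counit_right)

sublocale coalgebra \<subseteq> regular: coalgebra_comodule H "regular H"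
  by (intro coalgebra_comodule.intro coalgebra_axioms regular_comodule)

context coalgebra_comodule
begin

lemmas linear_comult = C.regular.linear_coact[unfolded regular_simps]

lemmas linear_intros = linear_scale_right linear_sum_list linear_coact linear_comult
  linear_ident vector_space_field M.vector_space_axioms C.vector_space_axioms C.counit_linear

lemma act2_bilinear:
  assumes M: "bilinear_map (ascale A) (ascale A) s M"
    and P: "bilinear_map (hscale H) (hscale H) (*) P"
  shows "bilinear_map (ascale A) (ascale A) s (act2 A s M P)"
proof -
  have s: "vector_space s" using M by (simp add: bilinear_map_def Vector_Spaces.linear_iff)
  show ?thesis
    unfolding bilinear_map_def act2_def
    by (intro allI conjI)
      (rule linear_intros linear_scale_coeff[OF s] bilinear_left[OF M] bilinear_right[OF M]
        bilinear_left[OF P] bilinear_right[OF P])+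
qed

lemma act3_trilinear:
  assumes M: "trilinear_map (ascale A) (ascale A) (ascale A) s M"
    and P: "trilinear_map (hscale H) (hscale H) (hscale H) (*) P"
  shows "trilinear_map (ascale A) (ascale A) (ascale A) s (act3 A s M P)"
proof -
  have s: "vector_space s" using M by (simp add: trilinear_map_def Vector_Spaces.linear_iff)
  show ?thesis
    unfolding trilinear_map_def act3_def
    by (intro allI conjI)
      (rule linear_intros linear_scale_coeff[OF s] trilinear_1[OF M] trilinear_2[OF M] trilinear_3[OF M]
        trilinear_1[OF P] trilinear_2[OF P] trilinear_3[OF P])+
qed

text \<open>
  Coassociativity in two arguments at once, which amounts to coassociativity of the tensor product
  comodule \<open>A \<otimes> A\<close>. The sums over the legs of \<open>b\<close> are regarded as part of the trilinear map that
  receives the legs of \<open>a\<close>.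
\<close>

lemma coassoc_sum2:
  assumes 1: "\<And>y y' y''. trilinear_map (ascale A) (hscale H) (hscale H) t (\<lambda>x x' x''. f x x' x'' y y' y'')"
    and 2: "\<And>x x' x''. trilinear_map (ascale A) (hscale H) (hscale H) t (\<lambda>y y' y''. f x x' x'' y y' y'')"
  shows "(\<Sum>(a0, a1)\<leftarrow>coact A a. \<Sum>(b0, b1)\<leftarrow>coact A b.
      \<Sum>(a00, a01)\<leftarrow>coact A a0. \<Sum>(b00, b01)\<leftarrow>coact A b0. f a00 a01 a1 b00 b01 b1)
    = (\<Sum>(a0, a1)\<leftarrow>coact A a. \<Sum>(b0, b1)\<leftarrow>coact A b.
      \<Sum>(a11, a12)\<leftarrow>comult H a1. \<Sum>(b11, b12)\<leftarrow>comult H b1. f a0 a11 a12 b0 b11 b12)"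
    (is "?l = ?r")
proof -
  let ?g = "\<lambda>x x' x''. \<Sum>(b0, b1)\<leftarrow>coact A b. \<Sum>(b00, b01)\<leftarrow>coact A b0. f x x' x'' b00 b01 b1"
  have g: "trilinear_map (ascale A) (hscale H) (hscale H) t ?g"
    unfolding trilinear_map_def
    using 1 by (auto simp: trilinear_map_def intro!: linear_sum_list)
  have "?l = (\<Sum>(a0, a1)\<leftarrow>coact A a. \<Sum>(a00, a01)\<leftarrow>coact A a0. ?g a00 a01 a1)"
    by (intro sum_list_pair_cong sum_list_pair_commute)
  also have "\<dots> = (\<Sum>(a0, a1)\<leftarrow>coact A a. \<Sum>(a11, a12)\<leftarrow>comult H a1. ?g a0 a11 a12)"
    by (rule coact_coassoc_sum[OF g])
  also have "\<dots> = (\<Sum>(a0, a1)\<leftarrow>coact A a. \<Sum>(a11, a12)\<leftarrow>comult H a1.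
      \<Sum>(b0, b1)\<leftarrow>coact A b. \<Sum>(b11, b12)\<leftarrow>comult H b1. f a0 a11 a12 b0 b11 b12)"
    by (simp only: coact_coassoc_sum[OF 2])
  also have "\<dots> = ?r"
    by (intro sum_list_pair_cong sum_list_pair_commute)
  finally show ?thesis .
qed

text \<open>
  The module law \<open>(M \<triangleleft> P) \<triangleleft> Q = M \<triangleleft> (P * Q)\<close>: both sides are sums over three legs of each argument. On
  the left the coaction is applied twice, on the right the \<open>H\<close>-leg of a single coaction is split by the
  comultiplication, and coassociativity identifies the two.
\<close>

lemma act2_act2:
  assumes M: "bilinear_map (ascale A) (ascale A) s M"
    and P: "bilinear_map (hscale H) (hscale H) (*) P"
    and Q: "bilinear_map (hscale H) (hscale H) (*) Q"
  shows "act2 A s (act2 A s M P) Q = act2 A s M (conv2 H P Q)"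
proof (intro ext)
  fix a b
  have s: "vector_space s" using M by (simp add: bilinear_map_def Vector_Spaces.linear_iff)
  interpret s: vector_space s by (rule s)
  note rules = linear_intros linear_scale_coeff[OF s] bilinear_left[OF M] bilinear_right[OF M]
        bilinear_left[OF P] bilinear_right[OF P] bilinear_left[OF Q] bilinear_right[OF Q]
        linear_scale_coeff[OF vector_space_field]
  have l: "Vector_Spaces.linear s s (s c)" "Vector_Spaces.linear (*) s (\<lambda>c. s c v)" for c v
    by (rule rules s)+
  have "act2 A s (act2 A s M P) Q a b = (\<Sum>(a0, a1)\<leftarrow>coact A a. \<Sum>(b0, b1)\<leftarrow>coact A b.
      \<Sum>(a00, a01)\<leftarrow>coact A a0. \<Sum>(b00, b01)\<leftarrow>coact A b0. s (Q a1 b1 * P a01 b01) (M a00 b00))"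
    by (simp add: act2_def linear_apply_sum_list[OF l(1)])
  also have "\<dots> = (\<Sum>(a0, a1)\<leftarrow>coact A a. \<Sum>(b0, b1)\<leftarrow>coact A b.
      \<Sum>(a11, a12)\<leftarrow>comult H a1. \<Sum>(b11, b12)\<leftarrow>comult H b1. s (Q a12 b12 * P a11 b11) (M a0 b0))"
    by (rule coassoc_sum2[where t = s]; unfold trilinear_map_def; intro conjI allI; (rule rules)+)
  also have "\<dots> = act2 A s M (conv2 H P Q) a b"
    by (simp add: act2_def linear_apply_sum_list[OF l(2)])
  finally show "act2 A s (act2 A s M P) Q a b = act2 A s M (conv2 H P Q) a b" .
qed

text \<open>
  As for \<open>act2_act2\<close>: coassociativity is used in the first two arguments simultaneously and then in
  the third, whose sums are moved inside in between.
\<close>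

lemma act3_act3:
  assumes M: "trilinear_map (ascale A) (ascale A) (ascale A) s M"
    and P: "trilinear_map (hscale H) (hscale H) (hscale H) (*) P"
    and Q: "trilinear_map (hscale H) (hscale H) (hscale H) (*) Q"
  shows "act3 A s (act3 A s M P) Q = act3 A s M (conv3 H P Q)"
proof (intro ext)
  fix a b c
  have s: "vector_space s" using M by (simp add: trilinear_map_def Vector_Spaces.linear_iff)
  interpret s: vector_space s by (rule s)
  note rules = linear_intros linear_scale_coeff[OF s] trilinear_1[OF M] trilinear_2[OF M] trilinear_3[OF M]
        trilinear_1[OF P] trilinear_2[OF P] trilinear_3[OF P]
        trilinear_1[OF Q] trilinear_2[OF Q] trilinear_3[OF Q]
        linear_scale_coeff[OF vector_space_field]
  have l: "Vector_Spaces.linear s s (s c)" "Vector_Spaces.linear (*) s (\<lambda>c. s c v)" for c v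
    by (rule rules s)+
  let ?f = "\<lambda>x x' x'' y y' y'' z z' z''. s (Q x'' y'' z'' * P x' y' z') (M x y z)"
  have f3: "trilinear_map (ascale A) (hscale H) (hscale H) s (?f x x' x'' y y' y'')" for x x' x'' y y' y''
    unfolding trilinear_map_def by (intro conjI allI; (rule rules)+)
  have "act3 A s (act3 A s M P) Q a b c = (\<Sum>(a0, a1)\<leftarrow>coact A a. \<Sum>(b0, b1)\<leftarrow>coact A b.
      \<Sum>(c0, c1)\<leftarrow>coact A c. \<Sum>(a00, a01)\<leftarrow>coact A a0. \<Sum>(b00, b01)\<leftarrow>coact A b0. \<Sum>(c00, c01)\<leftarrow>coact A c0.
      ?f a00 a01 a1 b00 b01 b1 c00 c01 c1)"
    by (simp add: act3_def linear_apply_sum_list[OF l(1)])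
  also have "\<dots> = (\<Sum>(a0, a1)\<leftarrow>coact A a. \<Sum>(b0, b1)\<leftarrow>coact A b.
      \<Sum>(a00, a01)\<leftarrow>coact A a0. \<Sum>(b00, b01)\<leftarrow>coact A b0. \<Sum>(c0, c1)\<leftarrow>coact A c. \<Sum>(c00, c01)\<leftarrow>coact A c0.
      ?f a00 a01 a1 b00 b01 b1 c00 c01 c1)"
    by (rule sum_list_pair_cong, rule sum_list_pair_cong, rule HOL.trans[OF sum_list_pair_commute],
        rule sum_list_pair_cong, rule sum_list_pair_commute)
  also have "\<dots> = (\<Sum>(a0, a1)\<leftarrow>coact A a. \<Sum>(b0, b1)\<leftarrow>coact A b.
      \<Sum>(a11, a12)\<leftarrow>comult H a1. \<Sum>(b11, b12)\<leftarrow>comult H b1. \<Sum>(c0, c1)\<leftarrow>coact A c. \<Sum>(c00, c01)\<leftarrow>coact A c0.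
      ?f a0 a11 a12 b0 b11 b12 c00 c01 c1)"
    by (rule coassoc_sum2[where t = s]; unfold trilinear_map_def; intro conjI allI; (rule rules)+)
  also have "\<dots> = (\<Sum>(a0, a1)\<leftarrow>coact A a. \<Sum>(b0, b1)\<leftarrow>coact A b.
      \<Sum>(a11, a12)\<leftarrow>comult H a1. \<Sum>(b11, b12)\<leftarrow>comult H b1. \<Sum>(c0, c1)\<leftarrow>coact A c. \<Sum>(c11, c12)\<leftarrow>comult H c1.
      ?f a0 a11 a12 b0 b11 b12 c0 c11 c12)"
    by (simp only: coact_coassoc_sum[OF f3])
  also have "\<dots> = (\<Sum>(a0, a1)\<leftarrow>coact A a. \<Sum>(b0, b1)\<leftarrow>coact A b. \<Sum>(c0, c1)\<leftarrow>coact A c.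
      \<Sum>(a11, a12)\<leftarrow>comult H a1. \<Sum>(b11, b12)\<leftarrow>comult H b1. \<Sum>(c11, c12)\<leftarrow>comult H c1.
      ?f a0 a11 a12 b0 b11 b12 c0 c11 c12)"
    by (rule sum_list_pair_cong, rule sum_list_pair_cong, rule HOL.sym,
        rule HOL.trans[OF sum_list_pair_commute],
        rule sum_list_pair_cong, rule sum_list_pair_commute)
  also have "\<dots> = act3 A s M (conv3 H P Q) a b c"
    by (simp add: act3_def linear_apply_sum_list[OF l(2)])
  finally show "act3 A s (act3 A s M P) Q a b c = act3 A s M (conv3 H P Q) a b c" .
qed

lemma act2_counit:
  assumes M: "bilinear_map (ascale A) (ascale A) s M"
  shows "act2 A s M (\<lambda>a b. counit H a * counit H b) = M"
proof (intro ext)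
  fix a b
  have s: "vector_space s" using M by (simp add: bilinear_map_def Vector_Spaces.linear_iff)
  interpret s: vector_space s by (rule s)
  note rules = linear_intros bilinear_left[OF M] bilinear_right[OF M]
  have "act2 A s M (\<lambda>a b. counit H a * counit H b) a b = (\<Sum>(a0, a1)\<leftarrow>coact A a.
      \<Sum>(b0, b1)\<leftarrow>coact A b. s (counit H b1) (s (counit H a1) (M a0 b0)))"
    by (simp add: act2_def mult.commute)
  also have "\<dots> = (\<Sum>(a0, a1)\<leftarrow>coact A a. s (counit H a1) (M a0 b))"
    by (intro sum_list_pair_cong coact_counit_apply; (rule rules)+)
  also have "\<dots> = M a b"
    by (intro coact_counit_apply; (rule rules)+)
  finally show "act2 A s M (\<lambda>a b. counit H a * counit H b) a b = M a b" .
qed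

text \<open>
  The counit absorbs the coaction of \<open>a\<close>, so twisting an inner map by \<open>P\<close> is the same as acting with
  \<open>\<epsilon> \<otimes> P\<close> on the composite. The inner map is the product of \<open>A\<close> in one application and the functional
  \<open>F\<close> on \<open>H\<close> in another.
\<close>

lemma act3_counit_left:
  assumes N: "bilinear_map (ascale A) r s N"
  shows "act3 A s (\<lambda>a b c. N a (M b c)) (\<lambda>a b c. counit H a * P b c) a b c = N a (act2 A r M P b c)"
proof -
  interpret N: Vector_Spaces.linear r s "\<lambda>y. N x y" for x
    using N by (simp add: bilinear_map_def)
  note rules = linear_intros bilinear_left[OF N]
  have "act3 A s (\<lambda>a b c. N a (M b c)) (\<lambda>a b c. counit H a * P b c) a b c
      = (\<Sum>(b0, b1)\<leftarrow>coact A b. \<Sum>(c0, c1)\<leftarrow>coact A c. \<Sum>(a0, a1)\<leftarrow>coact A a.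
          s (counit H a1) (s (P b1 c1) (N a0 (M b0 c0))))"
    unfolding act3_def N.vs2.scale_scale
    by (rule HOL.trans[OF sum_list_pair_commute], rule sum_list_pair_cong, rule sum_list_pair_commute)
  also have "\<dots> = (\<Sum>(b0, b1)\<leftarrow>coact A b. \<Sum>(c0, c1)\<leftarrow>coact A c. s (P b1 c1) (N a (M b0 c0)))"
    by (intro sum_list_pair_cong coact_counit_apply; (rule rules)+)
  also have "\<dots> = N a (act2 A r M P b c)"
    by (simp add: act2_def linear_apply_sum_list[OF N.linear_axioms] N.scale)
  finally show ?thesis .
qed

lemma act3_counit_right:
  assumes N: "bilinear_map r (ascale A) s N"
  shows "act3 A s (\<lambda>a b c. N (M a b) c) (\<lambda>a b c. P a b * counit H c) a b c = N (act2 A r M P a b) c"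
proof -
  interpret N: Vector_Spaces.linear r s "\<lambda>x. N x y" for y
    using N by (simp add: bilinear_map_def)
  note rules = linear_intros bilinear_right[OF N]
  have "act3 A s (\<lambda>a b c. N (M a b) c) (\<lambda>a b c. P a b * counit H c) a b c
      = (\<Sum>(a0, a1)\<leftarrow>coact A a. \<Sum>(b0, b1)\<leftarrow>coact A b. \<Sum>(c0, c1)\<leftarrow>coact A c.
          s (counit H c1) (s (P a1 b1) (N (M a0 b0) c0)))"
    by (simp add: act3_def mult.commute)
  also have "\<dots> = (\<Sum>(a0, a1)\<leftarrow>coact A a. \<Sum>(b0, b1)\<leftarrow>coact A b. s (P a1 b1) (N (M a0 b0) c))"
    by (intro sum_list_pair_cong coact_counit_apply; (rule rules)+)
  also have "\<dots> = N (act2 A r M P a b) c"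
    by (simp add: act2_def linear_apply_sum_list[OF N.linear_axioms] N.scale)
  finally show ?thesis .
qed

end

section \<open>Comodules with a multiplicative coaction\<close>

text \<open>
  Both a comodule quasialgebra and \<open>H\<close> coacting on itself by comultiplication are of this kind. It thus
  serves for iterated products in \<open>A\<close> and for functionals such as \<open>F(1 \<otimes> \<mu>)\<close> on \<open>H\<close>.
\<close>

locale comodule_with_product = coalgebra_comodule H A
  for H :: "('k::field, 'h::ab_group_add) dual_quasi_hopf_data"
    and A :: "('k, 'h, 'a::ab_group_add) comodule_algebra_data" +
  assumes product_bilinear: "bilinear_map (ascale A) (ascale A) (ascale A) (amult A)"
    and coact_product:
      "tensor2_eq (ascale A) (hscale H) (coact A (amult A a b))
        (tensor2_mult (amult A) (hmult H) (coact A a) (coact A b))"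
begin

lemma coact_product_sum:
  assumes "bilinear_map (ascale A) (hscale H) t f"
  shows "(\<Sum>(x, y)\<leftarrow>coact A (amult A a b). f x y)
    = (\<Sum>(a0, a1)\<leftarrow>coact A a. \<Sum>(b0, b1)\<leftarrow>coact A b. f (amult A a0 b0) (hmult H a1 b1))"
  using tensor2_eq_sum_eq[OF assms coact_product[of a b]]
  by (simp add: tensor2_mult_def sum_list_concat_map case_prod_unfold comp_def)

text \<open>
  By multiplicativity of the coaction, restricting \<open>M \<triangleleft> P\<close> to products \<open>ab\<close> in the first argument is the
  action of the restricted functional \<open>P(\<mu> \<otimes> 1)\<close> on the restricted map.
\<close>

lemma act2_product_left:
  assumes M: "bilinear_map (ascale A) (ascale A) s M"
    and P: "bilinear_map (hscale H) (hscale H) (*) P"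
  shows "act3 A s (\<lambda>a b c. M (amult A a b) c) (\<lambda>a b c. P (hmult H a b) c) a b c
    = act2 A s M P (amult A a b) c"
proof -
  have s: "vector_space s" using M by (simp add: bilinear_map_def Vector_Spaces.linear_iff)
  have f: "bilinear_map (ascale A) (hscale H) s (\<lambda>x y. \<Sum>(c0, c1)\<leftarrow>coact A c. s (P y c1) (M x c0))"
    unfolding bilinear_map_def
    by (intro conjI allI) (rule linear_intros linear_scale_coeff[OF s] bilinear_left[OF M] bilinear_left[OF P])+
  show ?thesis
    by (simp only: act2_def act3_def coact_product_sum[OF f])
qed

lemma act2_product_right:
  assumes M: "bilinear_map (ascale A) (ascale A) s M"
    and P: "bilinear_map (hscale H) (hscale H) (*) P"
  shows "act3 A s (\<lambda>a b c. M a (amult A b c)) (\<lambda>a b c. P a (hmult H b c)) a b c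
    = act2 A s M P a (amult A b c)"
proof -
  have s: "vector_space s" using M by (simp add: bilinear_map_def Vector_Spaces.linear_iff)
  have f: "bilinear_map (ascale A) (hscale H) s (\<lambda>x y. s (P a1 y) (M a0 x))" for a0 a1
    unfolding bilinear_map_def
    by (intro conjI allI) (rule linear_intros linear_scale_coeff[OF s] bilinear_right[OF M] bilinear_right[OF P])+
  show ?thesis
    by (simp only: act2_def act3_def coact_product_sum[OF f])
qed

end

section \<open>Reordering Sweedler sums\<close>

text \<open>
  The twist lists all legs of \<open>a\<close>, then all of \<open>b\<close>, then all of \<open>c\<close>; an iterated convolution first splits
  off one leg of each of them. This lemma passes from one order of summation to the other, one leg at
  a time.
\<close>

lemma sum_list_interleave:
  "(\<Sum>a\<leftarrow>as. \<Sum>x\<leftarrow>g a. \<Sum>b\<leftarrow>bs. \<Sum>y\<leftarrow>h b. \<Sum>c\<leftarrow>cs. \<Sum>z\<leftarrow>k c. f a x b y c z)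
    = (\<Sum>a\<leftarrow>as. \<Sum>b\<leftarrow>bs. \<Sum>c\<leftarrow>cs. \<Sum>x\<leftarrow>g a. \<Sum>y\<leftarrow>h b. \<Sum>z\<leftarrow>k c.
        (f a x b y c z :: 'b::comm_monoid_add))"
proof -
  have "(\<Sum>x\<leftarrow>g a. \<Sum>b\<leftarrow>bs. \<Sum>y\<leftarrow>h b. \<Sum>c\<leftarrow>cs. \<Sum>z\<leftarrow>k c. f a x b y c z)
      = (\<Sum>b\<leftarrow>bs. \<Sum>c\<leftarrow>cs. \<Sum>x\<leftarrow>g a. \<Sum>y\<leftarrow>h b. \<Sum>z\<leftarrow>k c. f a x b y c z)" for a
  proof -
    have "(\<Sum>x\<leftarrow>g a. \<Sum>b\<leftarrow>bs. \<Sum>y\<leftarrow>h b. \<Sum>c\<leftarrow>cs. \<Sum>z\<leftarrow>k c. f a x b y c z)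
        = (\<Sum>b\<leftarrow>bs. \<Sum>x\<leftarrow>g a. \<Sum>c\<leftarrow>cs. \<Sum>y\<leftarrow>h b. \<Sum>z\<leftarrow>k c. f a x b y c z)"
      by (subst sum_list_commute[of _ cs]) (rule sum_list_commute)
    also have "\<dots> = (\<Sum>b\<leftarrow>bs. \<Sum>c\<leftarrow>cs. \<Sum>x\<leftarrow>g a. \<Sum>y\<leftarrow>h b. \<Sum>z\<leftarrow>k c. f a x b y c z)"
      by (subst sum_list_commute[of _ cs]) (rule HOL.refl)
    finally show ?thesis .
  qed
  then show ?thesis by simp
qed

lemma sum_comult3:
  "(\<Sum>p\<leftarrow>comult3 H a. f p) = (\<Sum>p\<leftarrow>comult H a. \<Sum>q\<leftarrow>comult H (snd p). (f (fst p, q) :: 'b::comm_monoid_add))"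
  by (simp add: comult3_def sum_list_concat_map case_prod_unfold comp_def)

lemma sum_comult4:
  "(\<Sum>p\<leftarrow>comult4 H a. f p) = (\<Sum>p\<leftarrow>comult H a. \<Sum>q\<leftarrow>comult3 H (snd p). (f (fst p, q) :: 'b::comm_monoid_add))"
  by (simp add: comult4_def sum_list_concat_map case_prod_unfold comp_def)

lemma sum_comult5:
  "(\<Sum>p\<leftarrow>comult5 H a. f p) = (\<Sum>p\<leftarrow>comult H a. \<Sum>q\<leftarrow>comult4 H (snd p). (f (fst p, q) :: 'b::comm_monoid_add))"
  by (simp add: comult5_def sum_list_concat_map case_prod_unfold comp_def)

section \<open>Inverses in the convolution monoid\<close>

context coalgebra
begin

lemma counit_left_apply:
  assumes f: "Vector_Spaces.linear (hscale H) t f"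
  shows "(\<Sum>(a1, a2)\<leftarrow>comult H a. t (counit H a1) (f a2)) = f a"
proof -
  interpret f: Vector_Spaces.linear "hscale H" t f by (rule f)
  have "f a = f (\<Sum>(a1, a2)\<leftarrow>comult H a. hscale H (counit H a1) a2)" by (simp add: counit_left)
  also have "\<dots> = (\<Sum>(a1, a2)\<leftarrow>comult H a. t (counit H a1) (f a2))"
    by (simp add: linear_apply_sum_list[OF f] f.scale)
  finally show ?thesis by simp
qed

lemma conv2_counit_left:
  assumes P: "bilinear_map (hscale H) (hscale H) (*) P"
  shows "conv2 H (\<lambda>a b. counit H a * counit H b) P = P"
proof (intro ext)
  fix a b
  note rules = regular.linear_intros bilinear_left[OF P] bilinear_right[OF P]
  have "conv2 H (\<lambda>a b. counit H a * counit H b) P a b = (\<Sum>(a1, a2)\<leftarrow>comult H a.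
      \<Sum>(b1, b2)\<leftarrow>comult H b. counit H b1 * (counit H a1 * P a2 b2))"
    by (simp add: act2_def ac_simps)
  also have "\<dots> = (\<Sum>(a1, a2)\<leftarrow>comult H a. counit H a1 * P a2 b)"
    by (intro sum_list_pair_cong counit_left_apply; (rule rules)+)
  also have "\<dots> = P a b"
    by (intro counit_left_apply; (rule rules)+)
  finally show "conv2 H (\<lambda>a b. counit H a * counit H b) P a b = P a b" .
qed

lemma is_conv_inverse2_iff:
  "is_conv_inverse2 H P Q \<longleftrightarrow> bilinear_map (hscale H) (hscale H) (*) Q \<and>
    conv2 H P Q = (\<lambda>a b. counit H a * counit H b) \<and> conv2 H Q P = (\<lambda>a b. counit H a * counit H b)"
  by (simp add: is_conv_inverse2_def act2_def fun_eq_iff mult.commute)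

text \<open>
  Uniqueness of inverses in the convolution monoid justifies the definite description.
\<close>

lemma is_conv_inverse2_conv_inverse2:
  assumes P: "bilinear_map (hscale H) (hscale H) (*) P" and Q: "is_conv_inverse2 H P Q"
  shows "is_conv_inverse2 H P (conv_inverse2 H P)"
  unfolding conv_inverse2_def
proof (rule theI[of _ Q])
  fix Q' assume "is_conv_inverse2 H P Q'"
  then have Q': "bilinear_map (hscale H) (hscale H) (*) Q'" "conv2 H Q' P = (\<lambda>a b. counit H a * counit H b)"
    by (simp_all add: is_conv_inverse2_iff)
  have Q: "bilinear_map (hscale H) (hscale H) (*) Q" "conv2 H P Q = (\<lambda>a b. counit H a * counit H b)"
    using Q by (simp_all add: is_conv_inverse2_iff)
  have "Q' = conv2 H Q' (conv2 H P Q)"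
    using regular.act2_counit[of "(*)" Q'] Q' Q by simp
  also have "\<dots> = conv2 H (conv2 H Q' P) Q"
    using regular.act2_act2[of "(*)" Q' P Q] P Q Q' by simp
  also have "\<dots> = Q"
    using Q Q' by (simp add: conv2_counit_left)
  finally show "Q' = Q" .
qed (rule Q)

end

sublocale dual_quasibialgebra \<subseteq> regular: comodule_with_product H "regular H"
  by unfold_locales (simp_all only: regular_simps hmult_bilinear comult_hmult)

section \<open>Twisting by a 2-cochain\<close>

locale comodule_quasialgebra_twist = H: dual_quasibialgebra H + A: comodule_quasialgebra H A
  for H :: "('k::field, 'h::ab_group_add) dual_quasi_hopf_data"
    and A :: "('k, 'h, 'a::ab_group_add) comodule_algebra_data" +
  fixes F :: "'h \<Rightarrow> 'h \<Rightarrow> 'k"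
  assumes cochain: "cochain2 H F"

sublocale comodule_quasialgebra_twist \<subseteq> comodule_with_product H A
  by unfold_locales (simp_all only: A.amult_bilinear A.coact_amult)

context comodule_quasialgebra_twist
begin

abbreviation "F' \<equiv> conv_inverse2 H F"
abbreviation "mF \<equiv> act2 A (ascale A) (amult A) F"

lemma F_bilinear: "bilinear_map (hscale H) (hscale H) (*) F"
  using cochain by (simp add: cochain2_def)

lemma F'_bilinear: "bilinear_map (hscale H) (hscale H) (*) F'"
  and conv2_F_F': "conv2 H F F' = (\<lambda>a b. counit H a * counit H b)"
  using H.is_conv_inverse2_conv_inverse2[OF F_bilinear] cochain
  by (auto simp: cochain2_def H.is_conv_inverse2_iff)

lemma mF_bilinear: "bilinear_map (ascale A) (ascale A) (ascale A) mF"
  by (intro act2_bilinear product_bilinear F_bilinear)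

lemma twisted_amult: "amult (twist_comodule_algebra A F) = mF"
  by (simp add: twist_comodule_algebra_def act2_def fun_eq_iff)

text \<open>
  The twisted product of \<open>H\<close> is the conjugate of the given one by \<open>F\<close>. Testing it with functionals
  makes this a statement about scalar-valued convolution.
\<close>

lemma twisted_hmult_functional:
  assumes g: "Vector_Spaces.linear (hscale H) (*) g"
  shows "g (hmult (twist H F) a b) = conv2 H F' (conv2 H (\<lambda>a b. g (hmult H a b)) F) a b"
proof -
  interpret g: Vector_Spaces.linear "hscale H" "(*)" g by (rule g)
  have "g (hmult (twist H F) a b) = (\<Sum>(a1, a2, a3)\<leftarrow>comult3 H a. \<Sum>(b1, b2, b3)\<leftarrow>comult3 H b.
      F' a1 b1 * F a3 b3 * g (hmult H a2 b2))"
    by (simp add: twist_def case_prod_unfold g.scale linear_apply_sum[OF g])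
  also have "\<dots> = (\<Sum>p\<leftarrow>comult H a. \<Sum>p'\<leftarrow>comult H (snd p). \<Sum>q\<leftarrow>comult H b. \<Sum>q'\<leftarrow>comult H (snd q).
      F' (fst p) (fst q) * F (snd p') (snd q') * g (hmult H (fst p') (fst q')))"
    by (simp add: sum_comult3 case_prod_unfold)
  also have "\<dots> = (\<Sum>p\<leftarrow>comult H a. \<Sum>q\<leftarrow>comult H b. \<Sum>p'\<leftarrow>comult H (snd p). \<Sum>q'\<leftarrow>comult H (snd q).
      F' (fst p) (fst q) * F (snd p') (snd q') * g (hmult H (fst p') (fst q')))"
    by (subst sum_list_commute[of _ "comult H b"]) (rule HOL.refl)
  also have "\<dots> = (\<Sum>p\<leftarrow>comult H a. \<Sum>q\<leftarrow>comult H b. \<Sum>p'\<leftarrow>comult H (snd p). \<Sum>q'\<leftarrow>comult H (snd q).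
      F (snd p') (snd q') * g (hmult H (fst p') (fst q')) * F' (fst p) (fst q))"
    by (simp only: mult.assoc mult.commute[of "F' _ _"])
  also have "\<dots> = conv2 H F' (conv2 H (\<lambda>a b. g (hmult H a b)) F) a b"
    by (simp only: act2_def regular_simps case_prod_unfold sum_list_mult_const[symmetric])
  finally show ?thesis .
qed

text \<open>
  The first and the last factor of the defining formula involve only two of the three arguments. Padding
  them by the counit turns the formula into a convolution product of five functionals on
  \<open>H \<otimes> H \<otimes> H\<close>.
\<close>

lemma twisted_reassoc:
  "reassoc (twist H F) = conv3 H (\<lambda>a b c. counit H a * F' b c) (conv3 H (\<lambda>a b c. F' a (hmult H b c))
    (conv3 H (reassoc H) (conv3 H (\<lambda>a b c. F (hmult H a b) c) (\<lambda>a b c. F a b * counit H c))))"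
    (is "_ = conv3 H ?G2 (conv3 H ?G1 (conv3 H _ (conv3 H ?F3 ?F4)))")
proof (intro ext)
  fix a b c
  note lin = H.regular.linear_intros[unfolded regular_simps] linear_scale_coeff[OF vector_space_field]
    bilinear_left[OF F_bilinear] bilinear_right[OF F_bilinear]
    bilinear_left[OF F'_bilinear] bilinear_right[OF F'_bilinear]
    bilinear_left[OF H.hmult_bilinear] bilinear_right[OF H.hmult_bilinear]
    trilinear_1[OF H.reassoc_trilinear] trilinear_2[OF H.reassoc_trilinear] trilinear_3[OF H.reassoc_trilinear]
  \<comment> \<open>The products of the last two, three and four factors.\<close>
  define Z where "Z = conv3 H ?F3 ?F4"
  define Y where "Y = conv3 H (reassoc H) Z"
  define X where "X = conv3 H ?G1 Y"
  have Z: "Z a b c = (\<Sum>(a1, a2)\<leftarrow>comult H a. \<Sum>(b1, b2)\<leftarrow>comult H b. F (hmult H a1 b1) c * F a2 b2)" for a b c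
  proof -
    have "Z a b c = (\<Sum>(a1, a2)\<leftarrow>comult H a. \<Sum>(b1, b2)\<leftarrow>comult H b. \<Sum>(c1, c2)\<leftarrow>comult H c.
        counit H c2 * (F (hmult H a1 b1) c1 * F a2 b2))"
      by (simp add: Z_def act3_def ac_simps)
    also have "\<dots> = (\<Sum>(a1, a2)\<leftarrow>comult H a. \<Sum>(b1, b2)\<leftarrow>comult H b. F (hmult H a1 b1) c * F a2 b2)"
      by (intro sum_list_pair_cong H.regular.coact_counit_apply[unfolded regular_simps]; (rule lin)+)
    finally show ?thesis .
  qed
  have Y: "Y a b c = (\<Sum>(a1, a2, a3)\<leftarrow>comult3 H a. \<Sum>(b1, b2, b3)\<leftarrow>comult3 H b. \<Sum>(c1, c2)\<leftarrow>comult H c.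
      reassoc H a1 b1 c1 * F (hmult H a2 b2) c2 * F a3 b3)" for a b c
    \<comment> \<open>The singleton \<open>[()]\<close> stands for an absent sum: only one leg of \<open>c\<close> is left in \<open>Z\<close>.\<close>
    using sum_list_interleave[where k = "\<lambda>_. [()]" and as = "comult H a" and g = "\<lambda>p. comult H (snd p)"
      and bs = "comult H b" and h = "\<lambda>p. comult H (snd p)" and cs = "comult H c" and
      f = "\<lambda>p p' q q' r _. reassoc H (fst p) (fst q) (fst r)
        * F (hmult H (fst p') (fst q')) (snd r) * F (snd p') (snd q')"]
    by (simp add: Y_def Z act3_def sum_comult3
        case_prod_unfold sum_list_const_mult[symmetric] ac_simps)
  have X: "X a b c = (\<Sum>(a1, a2, a3, a4)\<leftarrow>comult4 H a. \<Sum>(b1, b2, b3, b4)\<leftarrow>comult4 H b. \<Sum>(c1, c2, c3)\<leftarrow>comult3 H c.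
      F' a1 (hmult H b1 c1) * reassoc H a2 b2 c2 * F (hmult H a3 b3) c3 * F a4 b4)" for a b c
    using sum_list_interleave[where as = "comult H a" and g = "\<lambda>p. comult3 H (snd p)"
      and bs = "comult H b" and h = "\<lambda>p. comult3 H (snd p)" and cs = "comult H c"
      and k = "\<lambda>p. comult H (snd p)" and
      f = "\<lambda>p p' q q' r r'. F' (fst p) (hmult H (fst q) (fst r)) * reassoc H (fst p') (fst q') (fst r')
        * F (hmult H (fst (snd p')) (fst (snd q'))) (snd r') * F (snd (snd p')) (snd (snd q'))"]
    by (simp add: X_def Y act3_def sum_comult4 sum_comult3[where H = H and a = c]
        case_prod_unfold sum_list_const_mult[symmetric] ac_simps)
  have X_lin: "Vector_Spaces.linear (hscale H) (*) (\<lambda>a. X a b c)" for b c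
    unfolding X_def Y_def Z_def act3_def regular_simps by (rule lin)+
  have "conv3 H ?G2 X a b c = (\<Sum>(b1, b2)\<leftarrow>comult H b. \<Sum>(c1, c2)\<leftarrow>comult H c. \<Sum>(a1, a2)\<leftarrow>comult H a.
      counit H a1 * (X a2 b2 c2 * F' b1 c1))"
    unfolding act3_def regular_simps mult.left_commute[of "X _ _ _"]
    by (rule HOL.trans[OF sum_list_pair_commute], rule sum_list_pair_cong, rule sum_list_pair_commute)
  also have "\<dots> = (\<Sum>(b1, b2)\<leftarrow>comult H b. \<Sum>(c1, c2)\<leftarrow>comult H c. X a b2 c2 * F' b1 c1)"
    by (intro sum_list_pair_cong H.counit_left_apply; (rule lin X_lin)+)
  also have "\<dots> = reassoc (twist H F) a b c"
    \<comment> \<open>No leg of \<open>a\<close> is split off at this level.\<close>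
    using sum_list_interleave[where as = "[()]" and g = "\<lambda>_. comult4 H a"
      and bs = "comult H b" and h = "\<lambda>p. comult4 H (snd p)" and cs = "comult H c"
      and k = "\<lambda>p. comult3 H (snd p)" and
      f = "\<lambda>_ p q q' r r'. F' (fst q) (fst r) * F' (fst p) (hmult H (fst q') (fst r'))
        * reassoc H (fst (snd p)) (fst (snd q')) (fst (snd r'))
        * F (hmult H (fst (snd (snd p))) (fst (snd (snd q')))) (snd (snd r'))
        * F (snd (snd (snd p))) (snd (snd (snd q')))"]
    by (simp add: X twist_def sum_comult5 sum_comult4[where H = H and a = c]
        case_prod_unfold sum_list_const_mult[symmetric] ac_simps)
  finally show "reassoc (twist H F) a b c = conv3 H ?G2 (conv3 H ?G1 (conv3 H (reassoc H) (conv3 H ?F3 ?F4))) a b c"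
    by (simp add: X_def Y_def Z_def)
qed

text \<open>
  Both sides are computed as iterated actions on \<open>a(bc)\<close>. On the left the acting
  functionals are \<open>\<phi>\<close>, \<open>F(\<mu> \<otimes> 1)\<close> and \<open>F \<otimes> \<epsilon>\<close>; on the right the two leading factors of the twisted
  reassociator undo, outermost first, the two twists hidden in \<open>m\<^sub>F(1 \<otimes> m\<^sub>F)\<close>.
\<close>

lemma twisted_quasi_assoc:
  "mF (mF a b) c = act3 A (ascale A) (\<lambda>a b c. mF a (mF b c)) (reassoc (twist H F)) a b c"
proof -
  let ?s = "ascale A" and ?h = "hscale H" and ?T = "\<lambda>a b c. amult A a (amult A b c)"
  let ?F1 = "\<lambda>a b c. F a (hmult H b c)" and ?F2 = "\<lambda>a b c. counit H a * F b c"
  let ?F3 = "\<lambda>a b c. F (hmult H a b) c" and ?F4 = "\<lambda>a b c. F a b * counit H c"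
  let ?G1 = "\<lambda>a b c. F' a (hmult H b c)" and ?G2 = "\<lambda>a b c. counit H a * F' b c"
  let ?e = "\<lambda>a b c. counit H a * (counit H b * counit H c)"
  have scalar: "bilinear_map ?h (*) (*) (\<lambda>x y. counit H x * y)" "bilinear_map (*) ?h (*) (\<lambda>x y. x * counit H y)"
    unfolding bilinear_map_def
    by (intro conjI allI; (rule linear_intros linear_scale_coeff[OF vector_space_field])+)+
  have F: "trilinear_map ?h ?h ?h (*) ?F1" "trilinear_map ?h ?h ?h (*) ?F2"
      "trilinear_map ?h ?h ?h (*) ?F3" "trilinear_map ?h ?h ?h (*) ?F4"
      "trilinear_map ?h ?h ?h (*) ?G1" "trilinear_map ?h ?h ?h (*) ?G2"
    by (rule trilinear_nest_left trilinear_nest_right scalar F_bilinear F'_bilinear H.hmult_bilinear)+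
  have T: "trilinear_map ?s ?s ?s ?s ?T"
    and T1: "trilinear_map ?s ?s ?s ?s (\<lambda>a b c. mF a (amult A b c))"
    by (rule trilinear_nest_right mF_bilinear product_bilinear)+
  note act = act3_trilinear[OF _ H.reassoc_trilinear] act3_trilinear[OF _ F(1)] act3_trilinear[OF _ F(2)]
  note conv = H.regular.act3_trilinear[unfolded regular_simps]
  have e1: "conv3 H ?F1 ?G1 = ?e"
    using H.regular.act2_product_right[of "(*)" F F'] F_bilinear F'_bilinear
    by (simp add: fun_eq_iff conv2_F_F' H.counit_hmult)
  have e2: "conv3 H ?F2 ?G2 = ?e"
    using H.regular.act3_counit_left[of "(*)" "(*)" "\<lambda>x y. counit H x * y" F F'] scalar
    by (simp add: fun_eq_iff conv2_F_F')
  have unit: "act3 A ?s (\<lambda>a b c. N a (amult A b c)) ?e = (\<lambda>a b c. N a (amult A b c))"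
    if "bilinear_map ?s ?s ?s N" for N
    by (intro ext) (simp add: act3_counit_left[OF that] act2_counit[OF product_bilinear])
  have "(\<lambda>a b c. mF (mF a b) c) = act3 A ?s (\<lambda>a b c. mF (amult A a b) c) ?F4"
    by (intro ext) (rule act3_counit_right[OF mF_bilinear, symmetric])
  also have "(\<lambda>a b c. mF (amult A a b) c) = act3 A ?s (\<lambda>a b c. amult A (amult A a b) c) ?F3"
    by (intro ext) (rule act2_product_left[OF product_bilinear F_bilinear, symmetric])
  also have "(\<lambda>a b c. amult A (amult A a b) c) = act3 A ?s ?T (reassoc H)"
    by (intro ext) (simp add: A.amult_quasi_assoc act3_def)
  finally have lhs: "(\<lambda>a b c. mF (mF a b) c) = act3 A ?s (act3 A ?s (act3 A ?s ?T (reassoc H)) ?F3) ?F4" .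
  have T1_eq: "(\<lambda>a b c. mF a (amult A b c)) = act3 A ?s ?T ?F1"
    by (intro ext) (rule act2_product_right[OF product_bilinear F_bilinear, symmetric])
  have T2_eq: "(\<lambda>a b c. mF a (mF b c)) = act3 A ?s (\<lambda>a b c. mF a (amult A b c)) ?F2"
    by (intro ext) (rule act3_counit_left[OF mF_bilinear, symmetric])
  have T2: "trilinear_map ?s ?s ?s ?s (\<lambda>a b c. mF a (mF b c))"
    by (rule trilinear_nest_right mF_bilinear)+
  have c1: "act3 A ?s (\<lambda>a b c. mF a (mF b c)) ?G2 = (\<lambda>a b c. mF a (amult A b c))"
    unfolding T2_eq act3_act3[OF T1 F(2) F(6)] e2 by (rule unit[OF mF_bilinear])
  have c2: "act3 A ?s (\<lambda>a b c. mF a (amult A b c)) ?G1 = ?T"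
    unfolding T1_eq act3_act3[OF T F(1) F(5)] e1 by (rule unit[OF product_bilinear])
  have conv_trilinear:
    "trilinear_map ?h ?h ?h (*) (conv3 H ?F3 ?F4)"
    "trilinear_map ?h ?h ?h (*) (conv3 H (reassoc H) (conv3 H ?F3 ?F4))"
    "trilinear_map ?h ?h ?h (*) (conv3 H ?G1 (conv3 H (reassoc H) (conv3 H ?F3 ?F4)))"
    by (intro conv F H.reassoc_trilinear)+
  have "act3 A ?s (\<lambda>a b c. mF a (mF b c)) (reassoc (twist H F))
      = act3 A ?s (act3 A ?s (act3 A ?s ?T (reassoc H)) ?F3) ?F4"
    unfolding twisted_reassoc
    by (simp only: act3_act3[symmetric] T T1 T2 F conv_trilinear H.reassoc_trilinear act c1 c2)
  then show ?thesis using lhs by (simp add: fun_eq_iff)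
qed

text \<open>
  For a functional \<open>g\<close> let \<open>D\<close> be the induced operator \<open>x \<mapsto> \<Sum> g(x\<^sub>1) x\<^sub>0\<close> on \<open>A\<close>. By multiplicativity
  \<open>D m = m \<triangleleft> g\<mu>\<close>, so \<open>D m\<^sub>F = m \<triangleleft> (g\<mu> * F)\<close>. Writing \<open>m = m\<^sub>F \<triangleleft> F\<^sup>-\<close> turns the acting functional
  into the conjugate \<open>F\<^sup>- * g\<mu> * F = g\<mu>\<^sub>F\<close>.
\<close>

lemma twisted_coact_amult:
  "tensor2_eq (ascale A) (hscale H) (coact A (mF a b))
    (tensor2_mult mF (hmult (twist H F)) (coact A a) (coact A b))"
proof (rule tensor2_eq_if_functionals_eq)
  fix g assume g: "Vector_Spaces.linear (hscale H) (*) g"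
  let ?s = "ascale A" and ?m = "amult A" and ?g = "\<lambda>a b. g (hmult H a b)"
  define D where "D x = (\<Sum>(x0, x1)\<leftarrow>coact A x. ?s (g x1) x0)" for x
  have D: "Vector_Spaces.linear ?s ?s D"
    unfolding D_def by (rule linear_intros linear_scale_coeff[OF A.vector_space_axioms] g)+
  have f: "bilinear_map ?s (hscale H) ?s (\<lambda>x y. ?s (g y) x)"
    unfolding bilinear_map_def
    by (intro conjI allI; (rule linear_intros linear_scale_coeff[OF A.vector_space_axioms] g)+)+
  have g_bilinear: "bilinear_map (hscale H) (hscale H) (*) ?g"
    by (rule bilinear_linear_comp[OF g H.hmult_bilinear])
  have gF: "bilinear_map (hscale H) (hscale H) (*) (conv2 H ?g F)"
    using H.regular.act2_bilinear[of "(*)" ?g F] g_bilinear F_bilinear by simp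
  have D_m: "(\<lambda>a b. D (?m a b)) = act2 A ?s ?m ?g"
    by (simp add: D_def coact_product_sum[OF f] act2_def fun_eq_iff)
  have m: "act2 A ?s mF F' = ?m"
    by (simp add: act2_act2[OF product_bilinear F_bilinear F'_bilinear] conv2_F_F' act2_counit[OF product_bilinear])
  interpret D: Vector_Spaces.linear ?s ?s D by (rule D)
  have "D (mF a b) = act2 A ?s (\<lambda>a b. D (?m a b)) F a b"
    by (simp add: act2_def linear_apply_sum_list[OF D] D.scale)
  also have "\<dots> = act2 A ?s ?m (conv2 H ?g F) a b"
    by (simp add: D_m act2_act2[OF product_bilinear g_bilinear F_bilinear])
  also have "act2 A ?s ?m (conv2 H ?g F) = act2 A ?s mF (conv2 H F' (conv2 H ?g F))"
    using act2_act2[OF mF_bilinear F'_bilinear gF] by (simp only: m)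
  also have "conv2 H F' (conv2 H ?g F) = (\<lambda>a b. g (hmult (twist H F) a b))"
    by (simp add: fun_eq_iff twisted_hmult_functional[OF g])
  finally show "(\<Sum>(x, y)\<leftarrow>coact A (mF a b). ?s (g y) x)
      = (\<Sum>(x, y)\<leftarrow>tensor2_mult mF (hmult (twist H F)) (coact A a) (coact A b). ?s (g y) x)"
    unfolding D_def act2_def[of A ?s mF]
    by (simp add: tensor2_mult_def sum_list_concat_map case_prod_unfold comp_def)
qed (rule A.vector_space_axioms H.vector_space_axioms)+

lemma coact_aunit_sum:
  assumes "bilinear_map (ascale A) (hscale H) t f"
  shows "(\<Sum>(x, y)\<leftarrow>coact A (aunit A). f x y) = f (aunit A) (hunit H)"
  using tensor2_eq_sum_eq[OF assms A.coact_aunit] by simp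

lemma twisted_aunit: "mF (aunit A) a = a" "mF a (aunit A) = a"
proof -
  let ?s = "ascale A"
  note rules = linear_intros linear_scale_coeff[OF A.vector_space_axioms]
    bilinear_left[OF F_bilinear] bilinear_right[OF F_bilinear]
    bilinear_left[OF product_bilinear] bilinear_right[OF product_bilinear]
  have l: "bilinear_map ?s (hscale H) ?s (\<lambda>x y. \<Sum>(a0, a1)\<leftarrow>coact A a. ?s (F y a1) (amult A x a0))"
    and r: "bilinear_map ?s (hscale H) ?s (\<lambda>x y. ?s (F a1 y) (amult A a0 x))" for a0 a1
    unfolding bilinear_map_def by (intro conjI allI; (rule rules)+)+
  have F1: "F (hunit H) x = counit H x" "F x (hunit H) = counit H x" for x
    using cochain by (simp_all add: cochain2_def)
  show "mF (aunit A) a = a"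
    by (simp add: act2_def coact_aunit_sum[OF l] F1 A.aunit_left A.coact_counit)
  show "mF a (aunit A) = a"
    by (simp add: act2_def coact_aunit_sum[OF r] F1 A.aunit_right A.coact_counit)
qed

end

theorem proposition2p2:
  fixes H :: "('k::field, 'h::ab_group_add) dual_quasi_hopf_data"
    and A :: "('k, 'h, 'a::ab_group_add) comodule_algebra_data"
    and F :: "'h \<Rightarrow> 'h \<Rightarrow> 'k"
  assumes "dual_quasi_hopf_algebra H"
    and "comodule_quasialgebra H A"
    and "cochain2 H F"
  shows "comodule_quasialgebra (twist H F) (twist_comodule_algebra A F)"
proof -
  interpret comodule_quasialgebra_twist H A F
    using assms by (simp add: comodule_quasialgebra_twist_def comodule_quasialgebra_twist_axioms_def
        dual_quasi_hopf_algebra_def)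
  have H_simps: "hscale (twist H F) = hscale H" "comult (twist H F) = comult H"
    "counit (twist H F) = counit H" "hunit (twist H F) = hunit H"
    by (simp_all add: twist_def)
  have A_simps: "ascale (twist_comodule_algebra A F) = ascale A"
    "coact (twist_comodule_algebra A F) = coact A" "aunit (twist_comodule_algebra A F) = aunit A"
    by (simp_all add: twist_comodule_algebra_def)
  note simps = H_simps A_simps twisted_amult
  show ?thesis
    unfolding comodule_quasialgebra_def right_comodule_def comodule_quasialgebra_axioms_def
      right_comodule_axioms_def simps
    using twisted_quasi_assoc[unfolded act3_def]
    by (intro conjI allI A.vector_space_axioms A.coact_add A.coact_scale A.coact_coassoc A.coact_counit
        mF_bilinear twisted_aunit twisted_coact_amult A.coact_aunit)
qed

end
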